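(* Let $C>0$ be arbitrary. For all integers $N \geq 3$ and all real $0<t \le (\log N)^C$, we have \[ \frac{1}{\varphi (N)} \left| \left\{ a \in \mathbb{Z}_N^* \, : \, M \left( \frac{a}{N} \right) \ge t \log N \right\} \right| \le \frac{12}{\pi^2 t} + O \left( \frac{(\log \log N)^3}{t \log N} \right) \] with an implied constant depending only on $C$.
   Context: For an integer $N\ge 2$, $\mathbb{Z}_N^*$ denotes the set of integers $1\le a\le N$ coprime to $N$, and $\varphi$ is Euler's totient function. For $a\in\mathbb{Z}_N^*$, $a/N=[0;a_1,\ldots,a_r]$ is the canonical continued fraction expansion (with $a_r>1$), and $M(a/N)=\max_{1\le i\le r}a_i$ is the maximal partial quotient. *)

theory Defs
  imports Complex_Main "HOL-Number_Theory.Totient"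
begin

text \<open>The value of the finite continued fraction \<open>[0; a\<^sub>1, \<dots>, a\<^sub>r]\<close>; the empty list stands for \<open>[0;] = 0\<close>.\<close>

fun cf_value :: "nat list \<Rightarrow> real" where
  "cf_value [] = 0"
| "cf_value (a # as) = 1 / (real a + cf_value as)"

definition canonical_cf :: "real \<Rightarrow> nat list \<Rightarrow> bool" where
  "canonical_cf x as \<longleftrightarrow>
     as \<noteq> [] \<and> (\<forall>a\<in>set as. 1 \<le> a) \<and> 1 < last as \<and> x = cf_value as"

text \<open>Only meaningful for rational \<open>x\<close> with \<open>0 < x < 1\<close>, where the expansion exists and is unique
  (lemma \<open>canonical_cf_ex1\<close> below).\<close>

definition partial_quotients :: "real \<Rightarrow> nat list" where
  "partial_quotients x = (THE as. canonical_cf x as)"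

definition max_partial_quotient :: "real \<Rightarrow> nat" where
  "max_partial_quotient x = Max (set (partial_quotients x))"

definition unit_residues :: "nat \<Rightarrow> nat set" where
  "unit_residues N = {a. 1 \<le> a \<and> a \<le> N \<and> coprime a N}"

lemma canonical_cf_bounds:
  assumes "canonical_cf x as"
  shows "0 < x \<and> x < 1"
  using assms
proof (induction as arbitrary: x)
  case Nil
  then show ?case by (simp add: canonical_cf_def)
next
  case (Cons a as)
  show ?case
  proof (cases "as = []")
    case True
    then show ?thesis using Cons.prems by (auto simp: canonical_cf_def)
  next
    case False
    have "canonical_cf (cf_value as) as"
      using Cons.prems False by (auto simp: canonical_cf_def)
    then have "0 < cf_value as" using Cons.IH by blast
    moreover have "x = 1 / (real a + cf_value as)" "1 \<le> real a"
      using Cons.prems by (auto simp: canonical_cf_def)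
    ultimately show ?thesis by simp
  qed
qed

lemma canonical_cf_Cons:
  "canonical_cf x (a # as) \<longleftrightarrow>
     (if as = [] then 1 < a \<and> x = 1 / real a
      else 1 \<le> a \<and> canonical_cf (cf_value as) as \<and> x = 1 / (real a + cf_value as))"
  by (auto simp: canonical_cf_def)

lemma canonical_cf_head:
  assumes "canonical_cf x (a # as)"
  shows "a = nat \<lfloor>1 / x\<rfloor>" and "cf_value as = 1 / x - real a"
proof -
  have b: "0 \<le> cf_value as" "cf_value as < 1"
    using assms canonical_cf_bounds[of "cf_value as" as]
    by (auto simp: canonical_cf_Cons split: if_splits)
  have x: "1 / x = real a + cf_value as"
    using assms by (simp add: canonical_cf_def)
  have "\<lfloor>real a + cf_value as\<rfloor> = int a"
    by (rule floor_unique) (use b in auto)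
  then show "a = nat \<lfloor>1 / x\<rfloor>" using x by simp
  show "cf_value as = 1 / x - real a" using x by simp
qed

lemma canonical_cf_unique:
  assumes "canonical_cf x as" and "canonical_cf x bs"
  shows "as = bs"
  using assms
proof (induction as arbitrary: x bs)
  case Nil
  then show ?case by (simp add: canonical_cf_def)
next
  case (Cons a as)
  obtain b bs' where bs: "bs = b # bs'"
    using Cons.prems(2) by (cases bs) (auto simp: canonical_cf_def)
  have ab: "a = b"
    using canonical_cf_head(1) Cons.prems bs by metis
  then have v: "cf_value as = cf_value bs'"
    using canonical_cf_head(2) Cons.prems bs by metis
  have zero: "cs = [] \<longleftrightarrow> cf_value cs = 0" if "canonical_cf x (c # cs)" for c cs
    using that canonical_cf_bounds[of "cf_value cs" cs]
    by (auto simp: canonical_cf_Cons split: if_splits)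
  show ?case
  proof (cases "as = []")
    case True
    then show ?thesis using zero[of b bs'] Cons.prems bs v ab by simp
  next
    case False
    then have "bs' \<noteq> []" using zero Cons.prems bs v by metis
    then have "as = bs'"
      using Cons.IH[of "cf_value as" bs'] Cons.prems bs v False
      by (simp add: canonical_cf_Cons)
    then show ?thesis using bs ab by simp
  qed
qed

lemma canonical_cf_exists:
  fixes a N :: nat
  assumes "0 < a" and "a < N"
  shows "\<exists>as. canonical_cf (real a / real N) as"
  using assms
proof (induction a arbitrary: N rule: less_induct)
  case (less a)
  define q where "q = N div a"
  define r where "r = N mod a"
  have N: "real N = real q * real a + real r"
    unfolding q_def r_def by (metis div_mult_mod_eq of_nat_add of_nat_mult)
  have q1: "1 \<le> q"
    using less.prems by (simp add: q_def Suc_le_eq div_greater_zero_iff)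
  show ?case
  proof (cases "r = 0")
    case True
    have "q \<noteq> 1" using N True less.prems by auto
    then have "canonical_cf (real a / real N) [q]"
      using q1 N True less.prems by (auto simp: canonical_cf_Cons)
    then show ?thesis ..
  next
    case False
    have "r < a" using less.prems by (simp add: r_def)
    then obtain as where as: "canonical_cf (real r / real a) as"
      using less.IH[of r a] False by auto
    then have v: "cf_value as = real r / real a" "as \<noteq> []"
      by (auto simp: canonical_cf_def)
    have "real a / real N = 1 / (real q + real r / real a)"
      using N less.prems by (simp add: field_simps)
    then have "canonical_cf (real a / real N) (q # as)"
      using as v q1 by (simp add: canonical_cf_Cons)
    then show ?thesis ..
  qed
qed

lemma canonical_cf_ex1:
  fixes a N :: nat
  assumes "0 < a" and "a < N"
  shows "\<exists>!as. canonical_cf (real a / real N) as"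
  using canonical_cf_exists[OF assms] canonical_cf_unique by blast

end

theory Submission
  imports Defs "HOL-Analysis.Analysis" "HOL-Real_Asymp.Real_Asymp"
begin

text \<open>Write \<open>T = t ln N\<close>. A partial quotient \<open>\<ge> T\<close> of \<open>a/N\<close> yields \<open>q, r \<ge> 1\<close> with
  \<open>q a \<equiv> \<plusminus>r (mod N)\<close> and \<open>q r T \<le> N\<close>. If \<open>q \<le> r\<close>, then \<open>a/N\<close> lies within \<open>1/(T q\<^sup>2)\<close> of a fraction
  with denominator \<open>q \<le> Y = (N/T)\<^bsup>1/2\<^esup>\<close>; otherwise this holds for the inverse of \<open>a\<close> modulo \<open>N\<close>, with
  denominator \<open>r\<close>. So it suffices to count, twice, the units in the intervals around \<open>p N / q\<close> of
  half-length \<open>N/(T q\<^sup>2)\<close>, for coprime \<open>p \<le> q \<le> Y\<close>.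

  With \<open>ln E = O((ln ln N)\<^sup>2)\<close>, Brun's pure sieve gives the expected count, up to a relative error
  \<open>O(1 / ln N)\<close>, for \<open>q \<le> Y/E\<close>; the main term then follows from
  \<open>\<Sum>\<^bsub>q \<le> n\<^esub> \<phi>(q)/q\<^sup>2 \<le> (6/\<pi>\<^sup>2) ln n + O(1)\<close>. For \<open>Y/E < q \<le> Y\<close> the trivial count loses a factor
  \<open>N/\<phi>(N) = O(ln ln N)\<close>, and the sum of \<open>1/q\<close> over this range is \<open>O((ln ln N)\<^sup>2)\<close>, whence the exponent
  \<open>3\<close> in the error term.\<close>


section \<open>From large partial quotients to good rational approximations\<close>

text \<open>Induction along the Euclidean algorithm. Dropping the leading quotient \<open>c\<close>
  replaces \<open>a / N\<close> by \<open>s / a\<close> with \<open>s = N - c * a\<close>, and a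
  pair \<open>(p, q)\<close> for \<open>s / a\<close> becomes \<open>(q, q * c + p)\<close> for
  \<open>a / N\<close> with the same remainder \<open>r\<close>. The bound on
  \<open>p * r * x\<close> is carried along because the new denominator mixes \<open>p\<close> and
  \<open>q\<close>.\<close>

lemma cf_element_approximation:
  fixes a N x :: nat
  assumes "canonical_cf (real a / real N) xs" "x \<in> set xs" "0 < a" "0 < N"
  shows "\<exists>p q r :: nat. 0 < q \<and> 0 < r \<and> \<bar>int q * int a - int p * int N\<bar> = int r
           \<and> q * r * x \<le> N \<and> p * r * x \<le> a"
  using assms
proof (induction xs arbitrary: a N)
  case Nil
  then show ?case by simp
next
  case (Cons c cs)
  have aN: "a < N"
    using canonical_cf_bounds[OF Cons.prems(1)] Cons.prems(4) by simp
  have v: "cf_value cs = real N / real a - real c"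
    using canonical_cf_head(2)[OF Cons.prems(1)] by simp
  have v0: "0 \<le> cf_value cs"
    using Cons.prems(1) canonical_cf_bounds[of "cf_value cs" cs]
    by (auto simp: canonical_cf_Cons split: if_splits)
  have "real N = cf_value cs * real a + real c * real a"
    using v Cons.prems(3) by (simp add: field_simps)
  moreover have "0 \<le> cf_value cs * real a"
    using v0 by simp
  ultimately have "real c * real a \<le> real N" by linarith
  then have ca: "c * a \<le> N"
    by (metis of_nat_le_iff of_nat_mult)
  show ?case
  proof (cases "x = c")
    case True
    then show ?thesis
      \<comment> \<open>For the leading quotient the approximation is \<open>0 / 1\<close>, with
        remainder \<open>a\<close>.\<close>
      using Cons.prems(3) ca by (intro exI[of _ 0] exI[of _ 1] exI[of _ a]) (simp add: mult.commute)
  next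
    case False
    then have x: "x \<in> set cs" using Cons.prems(2) by simp
    then have cs: "canonical_cf (cf_value cs) cs"
      using Cons.prems(1) by (auto simp: canonical_cf_Cons split: if_splits)
    define s where "s = N - c * a"
    have s: "int s = int N - int c * int a"
      using ca by (simp add: s_def of_nat_diff)
    have vs: "cf_value cs = real s / real a"
      using v ca Cons.prems(3) by (simp add: s_def of_nat_diff field_simps)
    have "0 < s"
      using canonical_cf_bounds[OF cs] vs Cons.prems(3) by (simp add: zero_less_divide_iff)
    then obtain p q r :: nat where h: "0 < q" "0 < r" "\<bar>int q * int s - int p * int a\<bar> = int r"
        "q * r * x \<le> a" "p * r * x \<le> s"
      using Cons.IH[of s a] cs vs x Cons.prems(3) by auto
    have "0 < q * c + p"
    proof -
      have "1 \<le> c" using Cons.prems(1) by (simp add: canonical_cf_def)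
      then show ?thesis using h(1) by simp
    qed
    moreover have "\<bar>int (q * c + p) * int a - int q * int N\<bar> = int r"
    proof -
      have "int (q * c + p) * int a - int q * int N = - (int q * int s - int p * int a)"
        by (simp add: s algebra_simps)
      then show ?thesis using h(3) by simp
    qed
    moreover have "(q * c + p) * r * x \<le> N"
    proof -
      have "(q * c + p) * r * x = c * (q * r * x) + p * r * x"
        by (simp add: algebra_simps)
      also have "\<dots> \<le> c * a + s"
        by (intro add_mono mult_left_mono h) simp
      finally show ?thesis using ca by (simp add: s_def)
    qed
    ultimately show ?thesis
      using h(2,4) by blast
  qed
qed

lemma max_partial_quotient_approximation:
  fixes a N :: nat
  assumes "0 < a" "a < N"
  shows "\<exists>p q r :: nat. 0 < q \<and> 0 < r \<and> \<bar>int q * int a - int p * int N\<bar> = int r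
           \<and> q * r * max_partial_quotient (real a / real N) \<le> N"
proof -
  define xs where "xs = partial_quotients (real a / real N)"
  have xs: "canonical_cf (real a / real N) xs"
    unfolding xs_def partial_quotients_def
    by (rule theI'[OF canonical_cf_ex1[OF assms]])
  then have "Max (set xs) \<in> set xs"
    by (intro Max_in) (auto simp: canonical_cf_def)
  then show ?thesis
    using cf_element_approximation[OF xs, of "Max (set xs)"] assms
    by (auto simp: max_partial_quotient_def xs_def)
qed

text \<open>Cleared of divisions: \<open>b\<close> lies within \<open>N / (T * q ^ 2)\<close> of
  \<open>p * N / q\<close>, and \<open>q\<close> is at most \<open>sqrt (N / T)\<close>. Coprimality
  ensures that the numerators for a given \<open>q\<close> are later counted by
  \<open>totient q\<close>; \<open>p\<close> is an integer because the numerators constructed for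
  inverses carry a sign.\<close>

definition approximable_units :: "nat \<Rightarrow> real \<Rightarrow> nat set" where
  "approximable_units N T = {b \<in> unit_residues N. \<exists>q::nat. \<exists>p::int.
     0 < q \<and> coprime p (int q) \<and> real q ^ 2 * T \<le> real N
     \<and> \<bar>real b * real q - real_of_int p * real N\<bar> * real q * T \<le> real N}"

text \<open>Reducing \<open>p / q\<close> to lowest terms only decreases the denominator and the
  remainder, so the inequalities survive. The condition \<open>q \<le> r\<close> turns the bound on
  \<open>q * r * T\<close> into one on \<open>q ^ 2 * T\<close>.\<close>

lemma approximable_unitsI:
  fixes q :: nat and p :: int
  assumes b: "b \<in> unit_residues N" and q: "0 < q" and T: "0 < T"
    and r: "\<bar>int b * int q - p * int N\<bar> = int r"
    and qr: "q \<le> r" "real q * real r * T \<le> real N"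
  shows "b \<in> approximable_units N T"
proof -
  define g where "g = gcd p (int q)"
  have g0: "g > 0" using q by (simp add: g_def)
  define p' q' where "p' = p div g" and "q' = nat (int q div g)"
  have qd: "int q = g * int q'" 
    using g0 by (simp add: q'_def g_def pos_imp_zdiv_nonneg_iff)
  have pd: "p = g * p'" by (simp add: p'_def g_def)
  have "coprime p' (int q')"
  proof -
    have "int q' = int q div g" using g0 by (simp add: q'_def pos_imp_zdiv_nonneg_iff)
    then show ?thesis
      unfolding p'_def g_def using div_gcd_coprime[of p "int q"] q by simp
  qed
  moreover have q'0: "0 < q'" using qd q g0 by (cases "q' = 0") auto
  have gr: "1 \<le> real_of_int g" using g0 by simp
  have qr': "real q = real_of_int g * real q'"
    using arg_cong[OF qd, of real_of_int] by simp
  have q'q: "real q' \<le> real q"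
    unfolding qr' using mult_right_mono[OF gr, of "real q'"] by simp
  have "real q' ^ 2 * T \<le> real N"
  proof -
    have "real q' ^ 2 * T \<le> real q * real r * T"
      unfolding power2_eq_square using q'q qr(1) T by (intro mult_mono) auto
    then show ?thesis using qr(2) by simp
  qed
  moreover have "\<bar>real b * real q' - real_of_int p' * real N\<bar> * real q' * T \<le> real N"
  proof -
    have "\<bar>real b * real q - real_of_int p * real N\<bar> = real r"
      using arg_cong[OF r, of real_of_int] by simp
    moreover have "real b * real q - real_of_int p * real N
        = real_of_int g * (real b * real q' - real_of_int p' * real N)"
      unfolding qr' pd by (simp add: algebra_simps)
    ultimately have "real_of_int g * \<bar>real b * real q' - real_of_int p' * real N\<bar> = real r"
      using g0 by (simp add: abs_mult)
    then have "\<bar>real b * real q' - real_of_int p' * real N\<bar> \<le> real r"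
      using mult_right_mono[OF gr, of "\<bar>real b * real q' - real_of_int p' * real N\<bar>"] by simp
    then have "\<bar>real b * real q' - real_of_int p' * real N\<bar> * real q' * T \<le> real r * real q * T"
      using q'q T by (intro mult_mono) auto
    then show ?thesis using qr(2) by (simp add: mult.commute)
  qed
  ultimately show ?thesis
    using b q'0 unfolding approximable_units_def by blast
qed

text \<open>Multiplying \<open>q * a \<equiv> \<plusminus>r\<close> by the inverse \<open>b\<close>
  of \<open>a\<close> gives \<open>r * b \<equiv> \<plusminus>q\<close> modulo \<open>N\<close>.
  Inversion thus exchanges \<open>q\<close> and \<open>r\<close>, and the smaller of the two can
  always serve as the denominator.\<close>

lemma large_quotient_imp_approximable:
  fixes N a :: nat
  assumes N: "2 \<le> N" and a: "a \<in> unit_residues N" and T: "0 < T"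
    and M: "T \<le> real (max_partial_quotient (real a / real N))"
  shows "a \<in> approximable_units N T
    \<or> (\<exists>b \<in> approximable_units N T. [a * b = 1] (mod N))"
proof -
  have cop: "coprime a N" and "1 \<le> a" "a \<le> N" using a by (auto simp: unit_residues_def)
  moreover have "a \<noteq> N" using cop N by auto
  ultimately have "0 < a" "a < N" by auto
  then obtain p q r :: nat where h: "0 < q" "0 < r" "\<bar>int q * int a - int p * int N\<bar> = int r"
      "q * r * max_partial_quotient (real a / real N) \<le> N"
    using max_partial_quotient_approximation by blast
  have "real q * real r * T \<le> real q * real r * real (max_partial_quotient (real a / real N))"
    using M by (intro mult_left_mono) auto
  also have "\<dots> \<le> real N" using h(4) by (metis of_nat_le_iff of_nat_mult)
  finally have qrT: "real q * real r * T \<le> real N" .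
  show ?thesis
  proof (cases "q \<le> r")
    case True
    then show ?thesis
      using approximable_unitsI[OF a h(1) T _ True qrT, of "int p"] h(3) by (simp add: mult.commute)
  next
    case False
    obtain b0 where b0: "[a * b0 = 1] (mod N)" using cong_solve_coprime_nat[OF cop] by auto
    define b where "b = b0 mod N"
    have ab: "[a * b = 1] (mod N)" using b0 by (simp only: b_def Cong.cong_def mod_mult_right_eq)
    then have copb: "coprime b N"
      by (metis coprime_iff_invertible_nat mult.commute cong_sym One_nat_def)
    then have "b \<noteq> 0" using N by (intro notI) simp
    then have bu: "b \<in> unit_residues N" using copb N by (auto simp: unit_residues_def b_def less_imp_le)
    have "int N dvd int a * int b - 1"
      using ab by (metis cong_iff_dvd_diff cong_int_iff of_nat_mult of_nat_1)
    then obtain m where "int a * int b - 1 = int N * m" by (elim dvdE)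
    then have m: "int a * int b = 1 + int N * m" by simp
    obtain e :: int where e: "e = 1 \<or> e = -1" "int q * int a - int p * int N = e * int r"
    proof (cases "int q * int a - int p * int N \<ge> 0")
      case True
      then show ?thesis using h(3) that[of 1] by simp
    next
      case False
      then show ?thesis using h(3) that[of "-1"] by simp
    qed
    have ee: "e * e = 1" using e(1) by auto
    \<comment> \<open>The multiple of \<open>N\<close> that appears when
      \<open>q * a - p * N = e * r\<close> is multiplied by \<open>b\<close> and by the sign
      \<open>e\<close>, with \<open>a * b\<close> replaced by \<open>1 + N * m\<close>.\<close>
    define p2 where "p2 = e * (int q * m - int p * int b)"
    have "int b * int r - p2 * int N = e * int q"
    proof -
      have "e * int r * int b = int q * (int a * int b) - int p * int N * int b"
        by (simp add: e(2)[symmetric] algebra_simps)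
      also have "\<dots> = int q + int N * (int q * m - int p * int b)"
        by (simp add: m algebra_simps)
      finally have "e * (e * int r * int b) = e * (int q + int N * (int q * m - int p * int b))" by simp
      then have "(e * e) * (int r * int b) = e * int q + p2 * int N"
        by (simp add: p2_def algebra_simps)
      then show ?thesis unfolding ee by (simp add: mult.commute)
    qed
    then have "\<bar>int b * int r - p2 * int N\<bar> = int q" using e(1) by auto
    then have "b \<in> approximable_units N T"
      using approximable_unitsI[OF bu h(2) T, of p2 q] False qrT by (simp add: mult.commute mult.left_commute)
    then show ?thesis using ab by blast
  qed
qed

lemma finite_unit_residues: "finite (unit_residues N)"
  by (rule finite_subset[of _ "{..N}"]) (auto simp: unit_residues_def)

lemma finite_approximable_units: "finite (approximable_units N T)"
  by (rule finite_subset[OF _ finite_unit_residues[of N]]) (auto simp: approximable_units_def)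

text \<open>The factor 2 pays for the two alternatives: a unit is determined by its inverse modulo
  \<open>N\<close>, so the units with an inverse in \<open>B\<close> are at most as many as
  \<open>B\<close>.\<close>

lemma card_large_quotient_le:
  fixes N :: nat
  assumes N: "2 \<le> N" and T: "0 < T"
  shows "card {a \<in> unit_residues N. T \<le> real (max_partial_quotient (real a / real N))}
    \<le> 2 * card (approximable_units N T)"
proof -
  define B where "B = approximable_units N T"
  define D where "D = {a \<in> unit_residues N. \<exists>b\<in>B. [a * b = 1] (mod N)}"
  define f where "f a = (SOME b. b \<in> B \<and> [a * b = 1] (mod N))" for a
  have f: "f a \<in> B \<and> [a * f a = 1] (mod N)" if "a \<in> D" for a
    unfolding f_def by (rule someI_ex) (use that in \<open>auto simp: D_def\<close>)
  have "inj_on f D"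
  proof
    fix x y assume xy: "x \<in> D" "y \<in> D" "f x = f y"
    have "[x * f x = y * f x] (mod N)"
      using f[OF xy(1)] f[OF xy(2)] xy(3) by (metis cong_sym cong_trans)
    moreover have "coprime (f x) N"
      using f[OF xy(1)] by (auto simp: B_def approximable_units_def unit_residues_def)
    ultimately have c: "[x = y] (mod N)" by (simp add: cong_mult_rcancel_nat)
    have lt: "z < N" if "z \<in> D" for z
    proof -
      have "z \<noteq> N" using that N by (auto simp: D_def unit_residues_def)
      then show ?thesis using that by (auto simp: D_def unit_residues_def)
    qed
    show "x = y" using cong_less_modulus_unique_nat[OF c lt[OF xy(1)] lt[OF xy(2)]] .
  qed
  then have "card D \<le> card B"
    using f finite_approximable_units by (intro card_inj_on_le[of f]) (auto simp: B_def)
  moreover have "card {a \<in> unit_residues N. T \<le> real (max_partial_quotient (real a / real N))} \<le> card (B \<union> D)"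
  proof (rule card_mono)
    show "finite (B \<union> D)"
      using finite_approximable_units finite_unit_residues[of N] by (auto simp: B_def D_def)
    show "{a \<in> unit_residues N. T \<le> real (max_partial_quotient (real a / real N))} \<subseteq> B \<union> D"
      using large_quotient_imp_approximable[OF N _ T] by (auto simp: B_def D_def)
  qed
  ultimately show ?thesis using card_Un_le[of B D] unfolding B_def by linarith
qed


section \<open>Sums over subsets and products over primes\<close>

lemma sum_Pow_prod:
  fixes f :: "'a \<Rightarrow> 'b :: comm_semiring_1"
  assumes "finite S"
  shows "(\<Sum>A\<in>Pow S. \<Prod>x\<in>A. f x) = (\<Prod>x\<in>S. 1 + f x)"
  using prod_add[OF assms, of f "\<lambda>_. 1"] by (simp add: add.commute)

lemma sum_Pow_insert:
  assumes "finite S" "x \<notin> S"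
  shows "sum f (Pow (insert x S)) = sum f (Pow S) + (\<Sum>A\<in>Pow S. f (insert x A))"
proof -
  have "sum f (Pow (insert x S)) = sum f (Pow S) + sum f (insert x ` Pow S)"
    unfolding Pow_insert using assms by (intro sum.union_disjoint) auto
  also have "sum f (insert x ` Pow S) = (\<Sum>A\<in>Pow S. f (insert x A))"
    using assms(2) by (subst sum.reindex) (auto simp: inj_on_def)
  finally show ?thesis .
qed

lemma prod_dvd_of_pairwise_coprime:
  fixes f :: "'a \<Rightarrow> 'b :: semiring_gcd"
  assumes "finite A" "\<And>a. a \<in> A \<Longrightarrow> f a dvd x"
    and "\<And>a b. a \<in> A \<Longrightarrow> b \<in> A \<Longrightarrow> a \<noteq> b \<Longrightarrow> coprime (f a) (f b)"
  shows "prod f A dvd x"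
  using assms
proof (induction A rule: finite_induct)
  case empty
  then show ?case by simp
next
  case (insert a A)
  have "coprime (f a) (prod f A)"
    using insert.hyps insert.prems(2) by (intro prod_coprime_right) auto
  then show ?case
    using insert by (simp add: divides_mult)
qed

text \<open>The first term of Legendre's formula: each multiple of \<open>p\<close> up to
  \<open>n\<close> contributes at least one factor \<open>p\<close>.\<close>

lemma multiplicity_fact_ge:
  fixes n :: nat
  assumes "prime p"
  shows "n div p \<le> multiplicity p (fact n :: nat)"
proof (induction n)
  case 0
  then show ?case by simp
next
  case (Suc n)
  have p0: "p > 0" using assms prime_gt_0_nat by blast
  have "multiplicity p (fact (Suc n) :: nat) = multiplicity p (Suc n) + multiplicity p (fact n :: nat)"
    using assms by (simp only: fact_Suc of_nat_id) (subst prime_elem_multiplicity_mult_distrib; simp)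
  moreover have "Suc n div p \<le> multiplicity p (Suc n) + n div p"
  proof (cases "p dvd Suc n")
    case True
    then have "multiplicity p (Suc n) \<ge> 1"
      using assms by (simp add: multiplicity_geI prime_gt_1_nat Suc_leI prime_multiplicity_gt_zero_iff)
    then show ?thesis by (simp add: div_Suc)
  next
    case False
    then show ?thesis by (simp add: div_Suc dvd_eq_mod_eq_0)
  qed
  ultimately show ?case using Suc by linarith
qed

text \<open>The upper half of Mertens' first theorem with a crude constant. The product of the
  \<open>p ^ (n div p)\<close> divides \<open>fact n\<close>, which is at most \<open>n ^ n\<close>;
  logarithms then give the bound, with a factor 2 lost because \<open>n div p\<close> is only known
  to be at least half of \<open>n / p\<close>.\<close>

lemma sum_ln_div_prime_le:
  fixes n :: nat
  assumes "1 \<le> n"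
  shows "(\<Sum>p | prime p \<and> p \<le> n. ln (real p) / real p) \<le> 2 * ln (real n)"
proof -
  define P where "P = {p. prime p \<and> p \<le> n}"
  have fin: "finite P" unfolding P_def by (rule finite_subset[of _ "{..n}"]) auto
  have "(\<Prod>p\<in>P. p ^ (n div p)) dvd (fact n :: nat)"
  proof (rule prod_dvd_of_pairwise_coprime[OF fin])
    show "p ^ (n div p) dvd (fact n :: nat)" if "p \<in> P" for p
      using that multiplicity_fact_ge[of p n] by (auto simp: P_def intro!: multiplicity_dvd')
    show "coprime (p ^ (n div p)) (q ^ (n div q))" if "p \<in> P" "q \<in> P" "p \<noteq> q" for p q
      using that primes_coprime[of p q] by (auto simp: P_def)
  qed
  then have "(\<Prod>p\<in>P. p ^ (n div p)) \<le> (fact n :: nat)"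
    by (rule dvd_imp_le) simp
  also have "(fact n :: nat) \<le> n ^ n" using fact_le_power[of n, where 'a = nat] by simp
  finally have "real (\<Prod>p\<in>P. p ^ (n div p)) \<le> real (n ^ n)" by (simp only: of_nat_le_iff)
  then have "ln (\<Prod>p\<in>P. real p ^ (n div p)) \<le> ln (real n ^ n)"
    using assms by (intro ln_mono) (auto simp: P_def prime_gt_0_nat intro!: prod_pos)
  also have "ln (real n ^ n) = real n * ln (real n)"
    using assms by (simp add: ln_realpow)
  also have "ln (\<Prod>p\<in>P. real p ^ (n div p)) = (\<Sum>p\<in>P. real (n div p) * ln (real p))"
    by (subst ln_prod) (auto simp: P_def ln_realpow prime_gt_0_nat)
  finally have 1: "(\<Sum>p\<in>P. real (n div p) * ln (real p)) \<le> real n * ln (real n)" .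
  have "(\<Sum>p\<in>P. real n / 2 * (ln (real p) / real p)) \<le> (\<Sum>p\<in>P. real (n div p) * ln (real p))"
  proof (rule sum_mono)
    fix p assume p: "p \<in> P"
    then have p1: "1 < p" "p \<le> n" using prime_gt_1_nat[of p] by (auto simp: P_def)
    have "n < p * (n div p) + p" using p1 by (metis add.commute dividend_less_times_div gr_zeroI not_less_zero)
    moreover have "p \<le> p * (n div p)"
      using p1 by (simp add: div_greater_zero_iff Suc_leI)
    ultimately have "n \<le> 2 * (p * (n div p))" by linarith
    then have "real n \<le> real (2 * (p * (n div p)))" by (simp only: of_nat_le_iff)
    then have "real n / 2 / real p \<le> real (n div p)" using p1 by (simp add: field_simps)
    then have "real n / 2 / real p * ln (real p) \<le> real (n div p) * ln (real p)"
      using p1 by (intro mult_right_mono) auto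
    then show "real n / 2 * (ln (real p) / real p) \<le> real (n div p) * ln (real p)" by simp
  qed
  with 1 have "real n / 2 * (\<Sum>p\<in>P. ln (real p) / real p) \<le> real n * ln (real n)"
    by (simp add: sum_distrib_left)
  then show ?thesis using assms by (simp add: P_def field_simps)
qed

text \<open>Unique factorization: a set of primes is recovered as the prime factors of its product.
  A sum over subsets thereby becomes a sum over distinct integers.\<close>

lemma inj_on_prod_primes:
  fixes S :: "nat set"
  assumes "finite S" "\<And>p. p \<in> S \<Longrightarrow> prime p"
  shows "inj_on (\<lambda>A. \<Prod>A) (Pow S)"
proof -
  have "A = prime_factors (\<Prod>A)" if "A \<subseteq> S" for A
  proof -
    have fA: "finite A" using that assms(1) finite_subset by blast
    have nz: "\<Prod>A \<noteq> 0" using that assms(2)[of 0] fA by (auto simp: not_prime_0)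
    show ?thesis
    proof (intro equalityI subsetI)
      fix p assume "p \<in> A"
      then show "p \<in> prime_factors (\<Prod>A)"
        using fA nz that assms(2) by (auto simp: in_prime_factors_iff dvd_prod_eqI)
    next
      fix p assume p: "p \<in> prime_factors (\<Prod>A)"
      then obtain q where "q \<in> A" "p dvd q"
        using prime_dvd_prod_iff[OF fA, of p "\<lambda>x. x"] by (auto simp: in_prime_factors_iff)
      then show "p \<in> A" using p that assms(2) primes_dvd_imp_eq[of p q] by (auto simp: in_prime_factors_iff)
    qed
  qed
  then show ?thesis by (metis (no_types, lifting) PowD inj_onI)
qed

lemma sum_inverse_le_ln:
  fixes m n :: nat
  assumes "1 \<le> m" "m \<le> n"
  shows "(\<Sum>k\<in>{m<..n}. 1 / real k) \<le> ln (real n / real m)"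
  using assms(2)
proof (induction n rule: dec_induct)
  case base
  then show ?case using assms by simp
next
  case (step n)
  have n: "1 \<le> n" using step assms by simp
  have "{m<..Suc n} = insert (Suc n) {m<..n}" using step by auto
  then have "(\<Sum>k\<in>{m<..Suc n}. 1 / real k) = 1 / real (Suc n) + (\<Sum>k\<in>{m<..n}. 1 / real k)"
    by simp
  moreover have "1 / real (Suc n) \<le> ln (real (Suc n)) - ln (real n)"
  proof -
    have "ln (real n / real (Suc n)) \<le> real n / real (Suc n) - 1"
      using n by (intro ln_le_minus_one) simp
    also have "\<dots> = - 1 / real (Suc n)" by (simp add: field_simps)
    finally show ?thesis using n by (simp add: ln_div)
  qed
  ultimately show ?case using step.IH n assms(1) by (simp add: ln_div)
qed

lemma harmonic_sum_le_ln:
  fixes n :: nat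
  assumes "1 \<le> n"
  shows "(\<Sum>k=1..n. 1 / real k) \<le> 1 + ln (real n)"
proof -
  have "{1..n} = insert 1 {1<..n}" using assms by auto
  then show ?thesis using sum_inverse_le_ln[OF order.refl assms] by simp
qed

text \<open>Since \<open>ln\<close> is additive over the factors, a new prime \<open>x\<close>
  multiplies the sum by \<open>1 + 1 / x\<close> and adds \<open>ln x / x\<close> times the old
  product. Enlarging the added part by \<open>1 + 1 / x\<close> as well restores the product
  form.\<close>

lemma sum_Pow_ln_prod_le:
  fixes S :: "nat set"
  assumes "finite S" "\<And>p. p \<in> S \<Longrightarrow> 1 \<le> p"
  shows "(\<Sum>A\<in>Pow S. ln (\<Prod>p\<in>A. real p) * (\<Prod>p\<in>A. 1 / real p))
     \<le> (\<Sum>p\<in>S. ln (real p) / real p) * (\<Prod>p\<in>S. 1 + 1 / real p)"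
  using assms
proof (induction S rule: finite_induct)
  case empty
  then show ?case by simp
next
  case (insert x S)
  define G where "G S = (\<Sum>A\<in>Pow S. ln (\<Prod>p\<in>A. real p) * (\<Prod>p\<in>A. 1 / real p))" for S
  define W where "W = (\<Prod>p\<in>S. 1 + 1 / real p)"
  define H where "H = (\<Sum>p\<in>S. ln (real p) / real p)"
  have x: "1 \<le> real x" using insert.prems by force
  have pos: "0 \<le> W" unfolding W_def by (intro prod_nonneg) auto
  have "(\<Sum>A\<in>Pow S. ln (\<Prod>p\<in>insert x A. real p) * (\<Prod>p\<in>insert x A. 1 / real p))
     = (\<Sum>A\<in>Pow S. ln (real x) / real x * (\<Prod>p\<in>A. 1 / real p)
         + 1 / real x * (ln (\<Prod>p\<in>A. real p) * (\<Prod>p\<in>A. 1 / real p)))"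
  proof (rule sum.cong[OF refl])
    fix A assume A: "A \<in> Pow S"
    then have f: "finite A" "x \<notin> A" using insert.hyps finite_subset by auto
    have "0 < (\<Prod>p\<in>A. real p)" using A insert.prems by (intro prod_pos) force
    then have "ln (\<Prod>p\<in>insert x A. real p) = ln (real x) + ln (\<Prod>p\<in>A. real p)"
      unfolding prod.insert[OF f] using x by (intro ln_mult_pos) auto
    then show "ln (\<Prod>p\<in>insert x A. real p) * (\<Prod>p\<in>insert x A. 1 / real p)
        = ln (real x) / real x * (\<Prod>p\<in>A. 1 / real p)
         + 1 / real x * (ln (\<Prod>p\<in>A. real p) * (\<Prod>p\<in>A. 1 / real p))"
      using f by (simp only: prod.insert) (simp add: algebra_simps add_divide_distrib)
  qed
  also have "\<dots> = ln (real x) / real x * W + 1 / real x * G S"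
    using sum_Pow_prod[OF insert.hyps(1), of "\<lambda>p. 1 / real p"]
    by (simp only: sum.distrib sum_distrib_left[symmetric] G_def W_def)
  finally have "G (insert x S) = (1 + 1 / real x) * G S + ln (real x) / real x * W"
    using insert.hyps by (simp add: G_def sum_Pow_insert algebra_simps)
  also have "\<dots> \<le> (1 + 1 / real x) * (H * W) + (1 + 1 / real x) * (ln (real x) / real x * W)"
  proof (rule add_mono)
    show "(1 + 1 / real x) * G S \<le> (1 + 1 / real x) * (H * W)"
      using insert.IH insert.prems x by (intro mult_left_mono) (auto simp: G_def H_def W_def)
    have "0 \<le> ln (real x) / real x * W" using x pos by simp
    then show "ln (real x) / real x * W \<le> (1 + 1 / real x) * (ln (real x) / real x * W)"
      using x mult_right_mono[of 1 "1 + 1 / real x" "ln (real x) / real x * W"] by simp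
  qed
  also have "\<dots> = (ln (real x) / real x + H) * ((1 + 1 / real x) * W)"
    by (simp add: algebra_simps)
  finally show ?case using insert.hyps by (simp add: G_def H_def W_def)
qed

text \<open>The random squarefree number \<open>d\<close> composed of primes in \<open>S\<close>, taken with probability
  proportional to \<open>1/d\<close>, has \<open>ln d\<close> at most \<open>2 ln n\<close> on average. By Markov's inequality half of
  the mass lies on \<open>d \<le> n ^ 4\<close>, where a harmonic sum bounds it.\<close>

lemma prod_one_plus_inverse_primes_le:
  fixes S :: "nat set" and n :: nat
  assumes "1 \<le> n" and S: "\<And>p. p \<in> S \<Longrightarrow> prime p \<and> p \<le> n"
  shows "(\<Prod>p\<in>S. 1 + 1 / real p) \<le> 2 * (1 + 4 * ln (real n))"
\<comment> \<open>Set apart because \<open>ln n = 0\<close> could not be cancelled at the end of the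
  Markov argument.\<close>
proof (cases "n = 1")
  case True
  then have "S = {}" using S not_prime_1 prime_gt_1_nat by (metis equals0I leD)
  then show ?thesis using True by simp
next
  case False
  then have n: "1 < n" using assms by simp
  have fin: "finite S" by (rule finite_subset[of _ "{..n}"]) (use S in auto)
  have p1: "1 \<le> p" if "p \<in> S" for p using S[OF that] prime_ge_1_nat by blast
  define W where "W = (\<Prod>p\<in>S. 1 + 1 / real p)"
  have W0: "0 \<le> W" unfolding W_def by (intro prod_nonneg) auto
  define v where "v A = (\<Prod>p\<in>A. 1 / real p)" for A :: "nat set"
  have v0: "0 \<le> v A" for A unfolding v_def by (intro prod_nonneg) auto
  have vP: "v A = 1 / real (\<Prod>A)" for A
    unfolding v_def by (simp add: prod_dividef)
  define F where "F = {A \<in> Pow S. \<Prod>A \<le> n ^ 4}"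
  define G where "G = {A \<in> Pow S. \<not> \<Prod>A \<le> n ^ 4}"
  have W: "W = sum v F + sum v G"
  proof -
    have "W = sum v (Pow S)"
      unfolding W_def v_def using sum_Pow_prod[OF fin, of "\<lambda>p. 1 / real p"] by simp
    also have "Pow S = F \<union> G" by (auto simp: F_def G_def)
    also have "sum v (F \<union> G) = sum v F + sum v G"
      using fin by (intro sum.union_disjoint) (auto simp: F_def G_def)
    finally show ?thesis .
  qed
  have "4 * ln (real n) * sum v G \<le> (\<Sum>A\<in>G. ln (\<Prod>p\<in>A. real p) * v A)"
    unfolding sum_distrib_left
  proof (rule sum_mono)
    fix A assume "A \<in> G"
    then have "real (n ^ 4) \<le> real (\<Prod>A)" by (simp only: G_def of_nat_le_iff) auto
    then have "ln (real n ^ 4) \<le> ln (\<Prod>p\<in>A. real p)"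
      using n by (intro ln_mono) auto
    then have "4 * ln (real n) \<le> ln (\<Prod>p\<in>A. real p)" using n by (simp add: ln_realpow)
    then show "4 * ln (real n) * v A \<le> ln (\<Prod>p\<in>A. real p) * v A"
      using v0 by (rule mult_right_mono)
  qed
  also have "\<dots> \<le> (\<Sum>A\<in>Pow S. ln (\<Prod>p\<in>A. real p) * v A)"
  proof (rule sum_mono2)
    show "finite (Pow S)" using fin by simp
    show "G \<subseteq> Pow S" by (auto simp: G_def)
    fix A assume "A \<in> Pow S - G"
    then have "1 \<le> (\<Prod>p\<in>A. real p)" using p1 by (intro prod_ge_1) auto
    then show "0 \<le> ln (\<Prod>p\<in>A. real p) * v A" using v0 by simp
  qed
  also have "\<dots> \<le> (\<Sum>p\<in>S. ln (real p) / real p) * W"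
    unfolding v_def W_def by (rule sum_Pow_ln_prod_le[OF fin p1])
  also have "\<dots> \<le> 2 * ln (real n) * W"
  proof (rule mult_right_mono[OF _ W0])
    have "(\<Sum>p\<in>S. ln (real p) / real p) \<le> (\<Sum>p | prime p \<and> p \<le> n. ln (real p) / real p)"
      by (rule sum_mono2)
         (use S prime_ge_1_nat in \<open>auto intro!: divide_nonneg_nonneg finite_subset[of "{p. prime p \<and> p \<le> n}" "{..n}"]\<close>)
    also have "\<dots> \<le> 2 * ln (real n)" using n by (intro sum_ln_div_prime_le) simp
    finally show "(\<Sum>p\<in>S. ln (real p) / real p) \<le> 2 * ln (real n)" .
  qed
  finally have "2 * sum v G \<le> W" using n by simp
  moreover have "sum v F \<le> 1 + 4 * ln (real n)"
  proof -
    have inj: "inj_on (\<lambda>A. \<Prod>A) F"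
      by (rule inj_on_subset[OF inj_on_prod_primes[OF fin]]) (use S in \<open>auto simp: F_def\<close>)
    have "sum v F = (\<Sum>k\<in>(\<lambda>A. \<Prod>A) ` F. 1 / real k)"
      by (subst sum.reindex[OF inj]) (simp add: vP)
    also have "\<dots> \<le> (\<Sum>k=1..n ^ 4. 1 / real k)"
    proof (rule sum_mono2)
      show "(\<lambda>A. \<Prod>A) ` F \<subseteq> {1..n ^ 4}"
        using p1 by (auto simp: F_def Suc_le_eq intro!: prod_pos) force
    qed auto
    also have "\<dots> \<le> 1 + ln (real (n ^ 4))" using n by (intro harmonic_sum_le_ln) simp
    finally show ?thesis using n by (simp add: ln_realpow)
  qed
  ultimately show ?thesis using W by (simp add: W_def)
qed

text \<open>Telescopes, because each factor is \<open>(k - 1) * (k + 1) / k ^ 2\<close>. The value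
  stays above \<open>1 / 2\<close>.\<close>

lemma prod_one_minus_inverse_squares:
  fixes n :: nat
  assumes "1 \<le> n"
  shows "(\<Prod>k=2..n. 1 - 1 / real k ^ 2) = (real n + 1) / (2 * real n)"
  using assms
proof (induction n rule: dec_induct)
  case base
  then show ?case by simp
next
  case (step n)
  have "(\<Prod>k=2..Suc n. 1 - 1 / real k ^ 2) = (1 - 1 / real (Suc n) ^ 2) * ((real n + 1) / (2 * real n))"
    using step.hyps(1) step.IH by (subst prod.nat_ivl_Suc') simp_all
  also have "1 - 1 / real (Suc n) ^ 2 = real n * (real n + 2) / (real n + 1) ^ 2"
  proof -
    have "1 - 1 / x ^ 2 = (x - 1) * (x + 1) / x ^ 2" if "x \<noteq> 0" for x :: real
      using that by (simp add: divide_simps power2_eq_square) (simp add: algebra_simps)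
    from this[of "real (Suc n)"] show ?thesis by (simp add: add.commute)
  qed
  also have "real n * (real n + 2) / (real n + 1) ^ 2 * ((real n + 1) / (2 * real n))
      = (real (Suc n) + 1) / (2 * real (Suc n))"
    using step.hyps(1) by (simp add: divide_simps power2_eq_square) (simp add: algebra_simps)
  finally show ?case .
qed

text \<open>The two products multiply to a product of factors \<open>1 - 1 / p ^ 2\<close>, which
  exceeds that over all integers from 2 to \<open>n\<close> or equals it. An upper bound for the
  first product thus becomes a lower bound for the second.\<close>

lemma one_le_prod_one_minus_inverse_primes:
  fixes S :: "nat set" and n :: nat
  assumes "1 \<le> n" and S: "\<And>p. p \<in> S \<Longrightarrow> prime p \<and> p \<le> n"
  shows "1 \<le> 2 * (\<Prod>p\<in>S. 1 + 1 / real p) * (\<Prod>p\<in>S. 1 - 1 / real p)"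
proof -
  have sub: "S \<subseteq> {2..n}" using S prime_ge_2_nat by (meson atLeastAtMost_iff subsetI)
  define f where "f k = 1 - 1 / real k ^ 2" for k :: nat
  have f: "0 \<le> f k" "f k \<le> 1" if "2 \<le> k" for k
    using that by (auto simp: f_def)
  have "1 / 2 \<le> prod f {2..n}"
    using assms(1) unfolding f_def prod_one_minus_inverse_squares[OF assms(1)]
    by (simp add: field_simps)
  also have "prod f {2..n} = prod f ({2..n} - S) * prod f S"
    by (rule prod.subset_diff[OF sub]) simp
  also have "\<dots> \<le> 1 * prod f S"
    using f sub by (intro mult_right_mono prod_le_1 prod_nonneg) auto
  also have "prod f S = (\<Prod>p\<in>S. 1 + 1 / real p) * (\<Prod>p\<in>S. 1 - 1 / real p)"
    unfolding prod.distrib[symmetric] f_def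
    by (intro prod.cong) (auto simp: algebra_simps power2_eq_square)
  finally show ?thesis by simp
qed


section \<open>Brun's pure sieve\<close>

text \<open>The truncated inclusion-exclusion sum over a nonempty \<open>D\<close> telescopes to the number of
  \<open>k\<close>-subsets of \<open>D\<close> with one element removed.\<close>

lemma bonferroni_indicator:
  assumes "finite D" "even k"
  shows "(if D = {} then 1 else 0) \<le> (\<Sum>A | A \<in> Pow D \<and> card A \<le> k. (-1 :: real) ^ card A)"
proof (cases "D = {}")
  case True
  then have "{A. A \<in> Pow D \<and> card A \<le> k} = {{}}" by auto
  then show ?thesis using True by simp
next
  case False
  define D' where "D' = D - {SOME x. x \<in> D}"
  define x where "x = (SOME x. x \<in> D)"
  have D: "D = insert x D'" "x \<notin> D'" "finite D'"
    using False assms(1) someI_ex[of "\<lambda>x. x \<in> D"] by (auto simp: D'_def x_def)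
  define g where "g A = (if card A \<le> k then (-1 :: real) ^ card A else 0)" for A :: "'a set"
  have "0 \<le> (\<Sum>A\<in>Pow D'. g A + g (insert x A))"
  proof (rule sum_nonneg)
    fix A assume "A \<in> Pow D'"
    then have "card (insert x A) = Suc (card A)"
      using D finite_subset by (subst card_insert_disjoint) auto
    then show "0 \<le> g A + g (insert x A)"
      using assms(2) by (auto simp: g_def not_less_eq_eq le_antisym)
  qed
  also have "\<dots> = sum g (Pow D)"
    unfolding D(1) using D(2,3) by (simp add: sum_Pow_insert sum.distrib)
  also have "\<dots> = (\<Sum>A | A \<in> Pow D \<and> card A \<le> k. (-1 :: real) ^ card A)"
    unfolding g_def using assms(1) by (subst sum.inter_filter) auto
  finally show ?thesis using False by simp
qed

lemma finite_int_interval: "finite {b::int. \<bar>real_of_int b - u\<bar> \<le> h}"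
proof (rule finite_subset)
  show "{b::int. \<bar>real_of_int b - u\<bar> \<le> h} \<subseteq> {\<lceil>u - h\<rceil>..\<lfloor>u + h\<rfloor>}"
    by (auto simp: ceiling_le_iff le_floor_iff)
qed simp

text \<open>Division by \<open>d\<close> turns the multiples into the integers of a closed interval
  of length \<open>2 * h / d\<close>, whose number differs from the length by at most 1.\<close>

lemma card_multiples_in_interval:
  fixes d :: nat and u h :: real
  assumes "0 < d" "0 \<le> h"
  shows "\<bar>real (card {b::int. \<bar>real_of_int b - u\<bar> \<le> h \<and> int d dvd b}) - 2 * h / real d\<bar> \<le> 1"
proof -
  define x y where "x = (u - h) / real d" and "y = (u + h) / real d"
  have d: "0 < real d" using assms by simp
  have xy: "y - x = 2 * h / real d" using d by (simp add: x_def y_def field_simps)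
  have "{b::int. \<bar>real_of_int b - u\<bar> \<le> h \<and> int d dvd b} = (\<lambda>m. int d * m) ` {\<lceil>x\<rceil>..\<lfloor>y\<rfloor>}"
  proof (intro equalityI subsetI)
    fix b :: int assume b: "b \<in> {b. \<bar>real_of_int b - u\<bar> \<le> h \<and> int d dvd b}"
    then obtain m where m: "b = int d * m" by auto
    have "u - h \<le> real d * real_of_int m" "real d * real_of_int m \<le> u + h"
      using b by (auto simp: m)
    then have "x \<le> real_of_int m" "real_of_int m \<le> y"
      using d by (auto simp: x_def y_def field_simps)
    then show "b \<in> (\<lambda>m. int d * m) ` {\<lceil>x\<rceil>..\<lfloor>y\<rfloor>}"
      by (auto simp: m ceiling_le_iff le_floor_iff)
  next
    fix b :: int assume "b \<in> (\<lambda>m. int d * m) ` {\<lceil>x\<rceil>..\<lfloor>y\<rfloor>}"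
    then obtain m where "b = int d * m" "m \<in> {\<lceil>x\<rceil>..\<lfloor>y\<rfloor>}"
      by blast
    then have m: "b = int d * m" "x \<le> real_of_int m" "real_of_int m \<le> y"
      by (simp_all add: ceiling_le_iff le_floor_iff)
    then have "u - h \<le> real d * real_of_int m" "real d * real_of_int m \<le> u + h"
      using d by (auto simp: x_def y_def field_simps)
    then show "b \<in> {b. \<bar>real_of_int b - u\<bar> \<le> h \<and> int d dvd b}"
      by (auto simp: m)
  qed
  then have "card {b::int. \<bar>real_of_int b - u\<bar> \<le> h \<and> int d dvd b} = nat (\<lfloor>y\<rfloor> - \<lceil>x\<rceil> + 1)"
    using assms by (simp add: card_image inj_on_def)
  moreover have "real_of_int \<lfloor>y\<rfloor> > y - 1" "real_of_int \<lfloor>y\<rfloor> \<le> y" "real_of_int \<lceil>x\<rceil> < x + 1" "x \<le> real_of_int \<lceil>x\<rceil>"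
    by linarith+
  moreover have "0 \<le> y - x" using xy d assms by simp
  ultimately show ?thesis unfolding xy[symmetric] by (simp add: abs_le_iff) linarith
qed

text \<open>Inclusion-exclusion truncated at subsets of size \<open>k\<close>. Completing the sum to
  all subsets yields the product of the \<open>1 - 1 / p\<close>, the second term bounds the tail
  added for this, and the last term collects a rounding error of at most 1 for each subset
  kept.\<close>

lemma brun_pure_sieve:
  fixes S :: "nat set" and u h :: real and k :: nat
  assumes fin: "finite S" and S: "\<And>p. p \<in> S \<Longrightarrow> prime p" and k: "even k" and h: "0 \<le> h"
  shows "real (card {b::int. \<bar>real_of_int b - u\<bar> \<le> h \<and> (\<forall>p\<in>S. \<not> int p dvd b)})
    \<le> 2 * h * ((\<Prod>p\<in>S. 1 - 1 / real p) + (\<Prod>p\<in>S. 1 + 1 / real p) ^ 2 / 2 ^ k)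
      + real (card {A. A \<in> Pow S \<and> card A \<le> k})"
proof -
  define I where "I = {b::int. \<bar>real_of_int b - u\<bar> \<le> h}"
  define F where "F = {A. A \<in> Pow S \<and> card A \<le> k}"
  define v where "v A = (\<Prod>p\<in>A. 1 / real p)" for A :: "nat set"
  have v0: "0 \<le> v A" for A unfolding v_def by (intro prod_nonneg) auto
  have finI: "finite I" unfolding I_def by (rule finite_int_interval)
  have finF: "finite F" using fin by (simp add: F_def)
  have "real (card {b::int. \<bar>real_of_int b - u\<bar> \<le> h \<and> (\<forall>p\<in>S. \<not> int p dvd b)})
     = (\<Sum>b\<in>I. if {p\<in>S. int p dvd b} = {} then 1 else 0)"
  proof -
    have "{b::int. \<bar>real_of_int b - u\<bar> \<le> h \<and> (\<forall>p\<in>S. \<not> int p dvd b)}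
       = {b \<in> I. {p\<in>S. int p dvd b} = {}}" by (auto simp: I_def)
    then show ?thesis using finI by (simp add: sum.inter_filter[symmetric])
  qed
  also have "\<dots> \<le> (\<Sum>b\<in>I. \<Sum>A\<in>F. if \<forall>p\<in>A. int p dvd b then (-1) ^ card A else 0)"
  proof (rule sum_mono)
    fix b assume "b \<in> I"
    have "(if {p\<in>S. int p dvd b} = {} then 1 else 0)
       \<le> (\<Sum>A | A \<in> Pow {p\<in>S. int p dvd b} \<and> card A \<le> k. (-1 :: real) ^ card A)"
      by (rule bonferroni_indicator) (use fin k in auto)
    also have "{A. A \<in> Pow {p\<in>S. int p dvd b} \<and> card A \<le> k} = {A \<in> F. \<forall>p\<in>A. int p dvd b}"
      by (auto simp: F_def)
    finally show "(if {p\<in>S. int p dvd b} = {} then 1 else 0)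
       \<le> (\<Sum>A\<in>F. if \<forall>p\<in>A. int p dvd b then (-1 :: real) ^ card A else 0)"
      using finF by (simp add: sum.inter_filter[symmetric])
  qed
  also have "\<dots> = (\<Sum>A\<in>F. \<Sum>b\<in>I. if \<forall>p\<in>A. int p dvd b then (-1) ^ card A else 0)"
    by (rule sum.swap)
  also have "\<dots> \<le> (\<Sum>A\<in>F. 2 * h * ((-1) ^ card A * v A) + 1)"
  proof (rule sum_mono)
    fix A assume A: "A \<in> F"
    then have fA: "finite A" and sub: "A \<subseteq> S" using fin finite_subset by (auto simp: F_def)
    have iff: "(\<forall>p\<in>A. int p dvd b) \<longleftrightarrow> int (\<Prod>A) dvd b" for b
    proof
      assume "\<forall>p\<in>A. int p dvd b"
      then have "prod int A dvd b"
        using fA by (intro prod_dvd_of_pairwise_coprime)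
          (auto intro!: primes_coprime S subsetD[OF sub])
      then show "int (\<Prod>A) dvd b" by simp
    next
      assume "int (\<Prod>A) dvd b"
      moreover have "int p dvd int (\<Prod>A)" if "p \<in> A" for p
        using that fA by (metis dvd_prod_eqI of_nat_dvd_iff)
      ultimately show "\<forall>p\<in>A. int p dvd b" using dvd_trans by blast
    qed
    define c where "c = real (card {b::int. \<bar>real_of_int b - u\<bar> \<le> h \<and> int (\<Prod>A) dvd b})"
    have "(\<Sum>b\<in>I. if \<forall>p\<in>A. int p dvd b then (-1 :: real) ^ card A else 0)
      = (\<Sum>b\<in>{b\<in>I. int (\<Prod>A) dvd b}. (-1) ^ card A)"
      unfolding iff using finI by (simp only: sum.inter_filter)
    also have "\<dots> = (-1) ^ card A * c"
      by (simp add: c_def I_def)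
    also have "\<dots> \<le> 2 * h * ((-1) ^ card A * v A) + 1"
    proof -
      have "0 < \<Prod>A" using sub S prime_gt_0_nat by (intro prod_pos) (auto simp: subset_iff)
      then have "\<bar>c - 2 * h / real (\<Prod>A)\<bar> \<le> 1"
        unfolding c_def by (intro card_multiples_in_interval h)
      moreover have "2 * h / real (\<Prod>A) = 2 * h * v A"
        by (simp add: v_def prod_dividef)
      moreover have "(-1 :: real) ^ card A = 1 \<or> (-1 :: real) ^ card A = -1"
        by (cases "even (card A)") auto
      ultimately show ?thesis by auto
    qed
    finally show "(\<Sum>b\<in>I. if \<forall>p\<in>A. int p dvd b then (-1) ^ card A else 0)
        \<le> 2 * h * ((-1) ^ card A * v A) + 1" .
  qed
  also have "\<dots> = 2 * h * (\<Sum>A\<in>F. (-1) ^ card A * v A) + real (card F)"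
    by (simp add: sum.distrib sum_distrib_left)
  also have "\<dots> \<le> 2 * h * ((\<Prod>p\<in>S. 1 - 1 / real p) + (\<Prod>p\<in>S. 1 + 1 / real p) ^ 2 / 2 ^ k) + real (card F)"
  proof (intro add_right_mono mult_left_mono)
    have split: "(\<Sum>A\<in>Pow S. (-1) ^ card A * v A)
        = (\<Sum>A\<in>Pow S - F. (-1) ^ card A * v A) + (\<Sum>A\<in>F. (-1) ^ card A * v A)"
      by (rule sum.subset_diff) (use fin in \<open>auto simp: F_def\<close>)
    have full: "(\<Sum>A\<in>Pow S. (-1) ^ card A * v A) = (\<Prod>p\<in>S. 1 - 1 / real p)"
    proof -
      have "(\<Sum>A\<in>Pow S. (-1) ^ card A * v A) = (\<Sum>A\<in>Pow S. \<Prod>p\<in>A. (-1) * (1 / real p))"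
        by (simp only: prod.distrib v_def prod_constant)
      also have "\<dots> = (\<Prod>p\<in>S. 1 + (-1) * (1 / real p))" by (rule sum_Pow_prod[OF fin])
      finally show ?thesis by simp
    qed
    \<comment> \<open>Rankin's trick: outside \<open>F\<close> the weight
      \<open>2 ^ card A / 2 ^ k\<close> is at least 1, and with this weight the sum may be extended
      to all subsets, where it factors into a product again.\<close>
    have "- (\<Sum>A\<in>Pow S - F. (-1) ^ card A * v A) \<le> (\<Sum>A\<in>Pow S - F. 2 ^ card A * v A / 2 ^ k)"
      unfolding sum_negf[symmetric]
    proof (rule sum_mono)
      fix A assume "A \<in> Pow S - F"
      then have "k \<le> card A" by (auto simp: F_def)
      then have "(2 :: real) ^ k \<le> 2 ^ card A" by (intro power_increasing) auto
      then have "1 * v A \<le> 2 ^ card A / 2 ^ k * v A"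
        using v0 by (intro mult_right_mono) auto
      moreover have "- ((-1) ^ card A * v A) \<le> v A"
        using v0[of A] by (cases "even (card A)") auto
      ultimately show "- ((-1) ^ card A * v A) \<le> 2 ^ card A * v A / 2 ^ k" by simp
    qed
    also have "\<dots> \<le> (\<Sum>A\<in>Pow S. 2 ^ card A * v A / 2 ^ k)"
      using fin v0 by (intro sum_mono2) auto
    also have "\<dots> = (\<Sum>A\<in>Pow S. \<Prod>p\<in>A. 2 * (1 / real p)) / 2 ^ k"
      by (simp only: prod.distrib v_def prod_constant sum_divide_distrib)
    also have "\<dots> = (\<Prod>p\<in>S. 1 + 2 * (1 / real p)) / 2 ^ k"
      by (simp only: sum_Pow_prod[OF fin])
    also have "\<dots> \<le> (\<Prod>p\<in>S. (1 + 1 / real p) ^ 2) / 2 ^ k"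
      by (intro divide_right_mono prod_mono) (auto simp: power2_eq_square algebra_simps)
    also have "\<dots> = (\<Prod>p\<in>S. 1 + 1 / real p) ^ 2 / 2 ^ k"
      by (simp only: prod_power_distrib)
    finally show "(\<Sum>A\<in>F. (-1) ^ card A * v A)
        \<le> (\<Prod>p\<in>S. 1 - 1 / real p) + (\<Prod>p\<in>S. 1 + 1 / real p) ^ 2 / 2 ^ k"
      using split full by linarith
  qed (use h in simp)
  finally show ?thesis by (simp add: F_def)
qed

text \<open>Rankin's trick once more: each subset counted has weight
  \<open>lam ^ k / lam ^ card A\<close> at least 1, and the weights of all subsets sum to
  \<open>lam ^ k * (1 + 1 / lam) ^ card S\<close>.\<close>

lemma card_small_subsets_le:
  fixes lam :: real
  assumes fin: "finite S" and lam: "real (card S) \<le> lam" "1 \<le> lam"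
  shows "real (card {A. A \<in> Pow S \<and> card A \<le> k}) \<le> lam ^ k * exp 1"
proof -
  have "real (card {A. A \<in> Pow S \<and> card A \<le> k}) = (\<Sum>A | A \<in> Pow S \<and> card A \<le> k. 1)" by simp
  also have "\<dots> \<le> (\<Sum>A | A \<in> Pow S \<and> card A \<le> k. lam ^ k * (\<Prod>x\<in>A. 1 / lam))"
  proof (rule sum_mono)
    fix A assume "A \<in> {A. A \<in> Pow S \<and> card A \<le> k}"
    then have "lam ^ card A \<le> lam ^ k" using lam by (intro power_increasing) auto
    then show "1 \<le> lam ^ k * (\<Prod>x\<in>A. 1 / lam)" using lam by (simp add: field_simps)
  qed
  also have "\<dots> \<le> (\<Sum>A\<in>Pow S. lam ^ k * (\<Prod>x\<in>A. 1 / lam))"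
    using fin lam by (intro sum_mono2) auto
  also have "\<dots> = lam ^ k * (\<Prod>x\<in>S. 1 + 1 / lam)"
    by (simp only: sum_distrib_left[symmetric] sum_Pow_prod[OF fin])
  also have "\<dots> \<le> lam ^ k * exp 1"
  proof (rule mult_left_mono)
    have "(\<Prod>x\<in>S. 1 + 1 / lam) \<le> (\<Prod>x\<in>S. exp (1 / lam))"
      using lam by (intro prod_mono) auto
    also have "\<dots> = exp (real (card S) / lam)"
      by (simp add: exp_of_nat_mult[symmetric])
    also have "\<dots> \<le> exp 1" using lam by simp
    finally show "(\<Prod>x\<in>S. 1 + 1 / lam) \<le> exp 1" .
  qed (use lam in simp)
  finally show ?thesis .
qed


section \<open>The mean value of the totient function\<close>

definition totient_square_sum :: "nat \<Rightarrow> real" where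
  "totient_square_sum n = (\<Sum>q=1..n. real (totient q) / real q ^ 2)"

lemma totient_div_square_le:
  fixes q :: nat
  assumes "1 \<le> q"
  shows "real (totient q) / real q ^ 2 \<le> 1 / real q"
  using assms totient_le[of q] by (simp add: field_simps power2_eq_square)

lemma totient_square_sum_le:
  "totient_square_sum n \<le> real n"
proof -
  have "totient_square_sum n \<le> (\<Sum>q=1..n. 1)"
    unfolding totient_square_sum_def
  proof (rule sum_mono)
    fix q assume q: "q \<in> {1..n}"
    then have "real (totient q) / real q ^ 2 \<le> 1 / real q" by (intro totient_div_square_le) auto
    also have "\<dots> \<le> 1" using q by auto
    finally show "real (totient q) / real q ^ 2 \<le> 1" .
  qed
  then show ?thesis by simp
qed

text \<open>Gauss's identity, that \<open>totient d\<close> sums to \<open>m\<close> over the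
  divisors \<open>d\<close> of \<open>m\<close>, is divided by \<open>m ^ 2\<close>; the pairs
  \<open>(m, d)\<close> are then regrouped by the cofactor \<open>g = m div d\<close>.\<close>

lemma harmonic_sum_eq_totient_square_sums:
  "(\<Sum>m=1..n. 1 / real m) = (\<Sum>g=1..n. 1 / real g ^ 2 * totient_square_sum (n div g))"
proof -
  have "(\<Sum>m=1..n. 1 / real m) = (\<Sum>m=1..n. \<Sum>d | d dvd m. real (totient d) / real m ^ 2)"
  proof (rule sum.cong[OF refl])
    fix m assume m: "m \<in> {1..n}"
    have "(\<Sum>d | d dvd m. real (totient d) / real m ^ 2) = real m / real m ^ 2"
      using arg_cong[OF totient_divisor_sum[of m], of real]
      by (simp add: sum_divide_distrib[symmetric])
    also have "\<dots> = 1 / real m" by (simp add: power2_eq_square)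
    finally show "1 / real m = (\<Sum>d | d dvd m. real (totient d) / real m ^ 2)" ..
  qed
  also have "\<dots> = (\<Sum>(m, d)\<in>(SIGMA m:{1..n}. {d. d dvd m}). real (totient d) / real m ^ 2)"
    by (rule sum.Sigma) auto
  also have "\<dots> = (\<Sum>(g, d)\<in>(SIGMA g:{1..n}. {1..n div g}). 1 / real g ^ 2 * (real (totient d) / real d ^ 2))"
  proof (rule sum.reindex_bij_witness[of _ "\<lambda>(g, d). (g * d, d)" "\<lambda>(m, d). (m div d, d)"], goal_cases)
    case (1 a)
    then show ?case by auto
  next
    case (2 a)
    then obtain m d k where a: "a = (m, d)" "m = d * k" "1 \<le> m" "m \<le> n" by auto
    then have "1 \<le> d" "1 \<le> k" "d * k \<le> n" by auto
    moreover from this have "d \<le> n div k"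
      by (simp add: less_eq_div_iff_mult_less_eq)
    moreover have "k \<le> n"
      using \<open>1 \<le> d\<close> \<open>d * k \<le> n\<close> by (metis mult_le_mono1 nat_mult_1 order.trans)
    ultimately show ?case using a by auto
  next
    case (3 b)
    then show ?case by (auto dest!: order.trans[of 1])
  next
    case (4 b)
    then obtain g d where b: "b = (g, d)" "1 \<le> g" "g \<le> n" "1 \<le> d" "d \<le> n div g" by auto
    then have "d * g \<le> n" by (simp add: less_eq_div_iff_mult_less_eq)
    then show ?case using b by (auto simp: mult.commute)
  next
    case (5 a)
    then obtain m d k where a: "a = (m, d)" "m = d * k" "1 \<le> m" by auto
    then show ?case by (auto simp: power_mult_distrib)
  qed
  also have "\<dots> = (\<Sum>g=1..n. \<Sum>d=1..n div g. 1 / real g ^ 2 * (real (totient d) / real d ^ 2))"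
    by (rule sum.Sigma[symmetric]) auto
  finally show ?thesis by (simp only: totient_square_sum_def sum_distrib_left)
qed

text \<open>The terms beyond \<open>n div g\<close> are at most \<open>1 / q\<close>, and rounding
  down at most halves the quotient, so \<open>n / (n div g) \<le> 2 * g\<close>.\<close>

lemma totient_square_sum_div_ge:
  fixes n g :: nat
  assumes "1 \<le> g" "g \<le> n"
  shows "totient_square_sum n - ln (2 * real g) \<le> totient_square_sum (n div g)"
proof -
  define m where "m = n div g"
  have m: "1 \<le> m" "m \<le> n" using assms by (auto simp: m_def div_greater_zero_iff Suc_leI)
  have "n < g * m + g" unfolding m_def using assms
    by (metis add.commute dividend_less_times_div gr_zeroI not_one_le_zero)
  also have "\<dots> \<le> g * m + g * m" using m by simp
  finally have "real n \<le> real (g * m + g * m)" by (simp only: of_nat_le_iff)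
  then have ng: "real n / real m \<le> 2 * real g" using m by (simp add: field_simps)
  have "{1..n} = {1..m} \<union> {m<..n}" using m by auto
  then have "totient_square_sum n = totient_square_sum m + (\<Sum>q\<in>{m<..n}. real (totient q) / real q ^ 2)"
    unfolding totient_square_sum_def by (simp only:) (rule sum.union_disjoint; auto)
  also have "(\<Sum>q\<in>{m<..n}. real (totient q) / real q ^ 2) \<le> (\<Sum>q\<in>{m<..n}. 1 / real q)"
    by (intro sum_mono totient_div_square_le) auto
  also have "\<dots> \<le> ln (real n / real m)" by (rule sum_inverse_le_ln[OF m])
  also have "\<dots> \<le> ln (2 * real g)" using ng m by (intro ln_mono) auto
  finally show ?thesis by (simp add: m_def)
qed

text \<open>The Basel series converges to \<open>pi ^ 2 / 6\<close>, and its tail beyond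
  \<open>n\<close> is at most \<open>1 / n\<close> by comparison with the telescoping
  \<open>1 / (m * (m + 1))\<close>.\<close>

lemma sum_inverse_squares_ge:
  fixes n :: nat
  assumes "1 \<le> n"
  shows "pi ^ 2 / 6 - 1 / real n \<le> (\<Sum>g=1..n. 1 / real g ^ 2)"
proof -
  have "(\<Sum>g=1..m. 1 / real g ^ 2) \<le> (\<Sum>g=1..n. 1 / real g ^ 2) + 1 / real n - 1 / real m" if "n \<le> m" for m
    using that
  proof (induction m rule: dec_induct)
    case base
    then show ?case by simp
  next
    case (step m)
    have m: "0 < real m" using step assms by simp
    have "1 / real (Suc m) ^ 2 \<le> 1 / (real m * real (Suc m))"
      using m by (intro divide_left_mono) (auto simp: power2_eq_square)
    also have "\<dots> = 1 / real m - 1 / real (Suc m)" using m by (simp add: field_simps)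
    finally show ?case using step.IH by simp
  qed
  then have *: "(\<Sum>g=1..m. 1 / real g ^ 2) \<le> (\<Sum>g=1..n. 1 / real g ^ 2) + 1 / real n" if "n \<le> m" for m
    using that by (smt (verit) divide_nonneg_nonneg of_nat_0_le_iff)
  have lim: "(\<lambda>m. \<Sum>g=1..m. 1 / real g ^ 2) \<longlonglongrightarrow> pi ^ 2 / 6"
  proof -
    have "(\<Sum>k<m. 1 / (real k + 1) ^ 2) = (\<Sum>g=1..m. 1 / real g ^ 2)" for m
      by (rule sum.reindex_bij_witness[of _ "\<lambda>g. g - 1" Suc]) (auto simp: add.commute)
    then show ?thesis using inverse_squares_sums by (simp add: sums_def add.commute)
  qed
  have "pi ^ 2 / 6 \<le> (\<Sum>g=1..n. 1 / real g ^ 2) + 1 / real n"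
    by (rule LIMSEQ_le_const2[OF lim]) (use * in blast)
  then show ?thesis by simp
qed

lemma sum_ln_div_square_bounded:
  "\<exists>c. \<forall>n. (\<Sum>g=1..n. 1 / real g ^ 2 * ln (2 * real g)) \<le> c"
proof -
  have "summable (\<lambda>g. 1 / real g ^ 2 * ln (2 * real g))"
  proof (rule summable_comparison_test_ev)
    \<comment> \<open>Any decay exponent strictly between 1 and 2 works: it absorbs the logarithm
      and keeps the series convergent.\<close>
    show "\<forall>\<^sub>F g in sequentially. norm (1 / real g ^ 2 * ln (2 * real g)) \<le> real g powr (-3/2)"
      unfolding real_norm_def by real_asymp
    show "summable (\<lambda>g. real g powr (-3/2))" by (simp add: summable_real_powr_iff)
  qed
  then have "(\<Sum>g=1..n. 1 / real g ^ 2 * ln (2 * real g)) \<le> (\<Sum>g. 1 / real g ^ 2 * ln (2 * real g))" for n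
  proof (rule sum_le_suminf)
    fix g :: nat
    show "0 \<le> 1 / real g ^ 2 * ln (2 * real g)" by (cases "g = 0") auto
  qed auto
  then show ?thesis by blast
qed

text \<open>Replacing \<open>n div g\<close> by \<open>n\<close> costs only \<open>O(ln (2 g))\<close>, which is summable against \<open>1/g\<^sup>2\<close>; so the
  harmonic identity can be solved for the sum up to \<open>n\<close> without Moebius inversion.\<close>

lemma totient_square_sum_asymp_le:
  "\<exists>c\<ge>0. \<forall>n\<ge>1. totient_square_sum n \<le> 6 / pi ^ 2 * ln (real n) + c"
proof -
  obtain c where c: "(\<Sum>g=1..n. 1 / real g ^ 2 * ln (2 * real g)) \<le> c" for n
    using sum_ln_div_square_bounded by blast
  have "totient_square_sum n \<le> 6 / pi ^ 2 * ln (real n) + 6 / pi ^ 2 * (2 + max c 0)" if n: "1 \<le> n" for n :: nat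
  proof -
    define X where "X = totient_square_sum n"
    have X0: "0 \<le> X" unfolding X_def totient_square_sum_def by (intro sum_nonneg) auto
    have "(pi ^ 2 / 6 - 1 / real n) * X \<le> (\<Sum>g=1..n. 1 / real g ^ 2) * X"
      by (rule mult_right_mono[OF sum_inverse_squares_ge[OF n] X0])
    also have "\<dots> = (\<Sum>g=1..n. 1 / real g ^ 2 * (X - ln (2 * real g)))
        + (\<Sum>g=1..n. 1 / real g ^ 2 * ln (2 * real g))"
      by (simp add: sum.distrib[symmetric] sum_distrib_right right_diff_distrib)
    also have "(\<Sum>g=1..n. 1 / real g ^ 2 * (X - ln (2 * real g)))
        \<le> (\<Sum>g=1..n. 1 / real g ^ 2 * totient_square_sum (n div g))"
      unfolding X_def by (intro sum_mono mult_left_mono totient_square_sum_div_ge) auto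
    also have "\<dots> = (\<Sum>m=1..n. 1 / real m)" by (rule harmonic_sum_eq_totient_square_sums[symmetric])
    also have "\<dots> \<le> 1 + ln (real n)" by (rule harmonic_sum_le_ln[OF n])
    finally have "pi ^ 2 / 6 * X - X / real n \<le> 1 + ln (real n) + c"
      using c[of n] by (simp add: algebra_simps)
    \<comment> \<open>The trivial bound \<open>X \<le> n\<close> absorbs the missing tail of the
      Basel series.\<close>
    moreover have "X / real n \<le> 1"
      using totient_square_sum_le[of n] n by (simp add: X_def)
    ultimately have "pi ^ 2 / 6 * X \<le> ln (real n) + (2 + max c 0)" by linarith
    then have "6 / pi ^ 2 * (pi ^ 2 / 6 * X) \<le> 6 / pi ^ 2 * (ln (real n) + (2 + max c 0))"
      by (intro mult_left_mono) auto
    then show ?thesis by (simp add: X_def distrib_left)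
  qed
  then show ?thesis by (intro exI[of _ "6 / pi ^ 2 * (2 + max c 0)"]) auto
qed


section \<open>Integers coprime to \<open>N\<close> in an interval\<close>

text \<open>The distinct prime factors are all at least 2 and their product is at most
  \<open>N\<close>; the constant comes from \<open>ln 2 \<ge> 1 / 2\<close>.\<close>

lemma card_prime_factors_le:
  fixes N :: nat
  assumes "1 \<le> N"
  shows "real (card (prime_factors N)) \<le> 2 * ln (real N)"
proof -
  have "2 ^ card (prime_factors N) = (\<Prod>p\<in>prime_factors N. 2 :: nat)" by simp
  also have "\<dots> \<le> (\<Prod>p\<in>prime_factors N. p)"
    by (intro prod_mono) (auto simp: in_prime_factors_iff prime_ge_2_nat)
  also have "\<dots> \<le> N"
  proof (rule dvd_imp_le)
    show "(\<Prod>p\<in>prime_factors N. p) dvd N"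
      by (rule prod_dvd_of_pairwise_coprime) (auto simp: in_prime_factors_iff primes_coprime)
  qed (use assms in simp)
  finally have "real (2 ^ card (prime_factors N)) \<le> real N" by (simp only: of_nat_le_iff)
  then have "ln (2 ^ card (prime_factors N)) \<le> ln (real N)"
    by (intro ln_mono) auto
  then have "real (card (prime_factors N)) * ln 2 \<le> ln (real N)" by (simp add: ln_realpow)
  moreover have "real (card (prime_factors N)) * (1 / 2) \<le> real (card (prime_factors N)) * ln 2"
    using ln2_ge_two_thirds by (intro mult_left_mono) auto
  ultimately show ?thesis by linarith
qed

text \<open>The Weierstrass product inequality.\<close>

lemma prod_one_minus_ge:
  fixes f :: "'a \<Rightarrow> real"
  assumes "finite A" "\<And>x. x \<in> A \<Longrightarrow> 0 \<le> f x \<and> f x \<le> 1"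
  shows "1 - sum f A \<le> (\<Prod>x\<in>A. 1 - f x)"
  using assms
proof (induction A rule: finite_induct)
  case empty
  then show ?case by simp
next
  case (insert x A)
  define P where "P = (\<Prod>x\<in>A. 1 - f x)"
  have "P \<le> 1" unfolding P_def using insert.prems by (intro prod_le_1) auto
  then have "f x * P \<le> f x * 1" using insert.prems by (intro mult_left_mono) auto
  moreover have "1 - sum f A \<le> P" unfolding P_def using insert by auto
  ultimately show ?case using insert.hyps by (simp add: P_def[symmetric] algebra_simps)
qed

text \<open>The sieve uses only the primes up to \<open>4 (ln N)\<^sup>2\<close>: as \<open>N\<close> has at most \<open>2 ln N\<close> prime factors,
  the others change \<open>\<phi>(N)/N\<close> by a factor \<open>1 + O(1 / ln N)\<close> only.\<close>

lemma totient_small_primes: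
  fixes N :: nat and L :: real and S :: "nat set"
  defines "L \<equiv> ln (real N)" and "S \<equiv> {p \<in> prime_factors N. real p \<le> 4 * ln (real N) ^ 2}"
  defines "V \<equiv> (\<Prod>p\<in>S. 1 - 1 / real p)"
  assumes L1: "1 \<le> L"
  shows "V \<le> real (totient N) / real N * (1 + 1 / L)" "real (totient N) / real N \<ge> V / 2"
proof -
  have N: "1 \<le> N" using L1 by (cases "N = 0") (auto simp: L_def)
  define R where "R = prime_factors N - S"
  have p2: "2 \<le> p" if "p \<in> prime_factors N" for p
    using that by (auto simp: in_prime_factors_iff prime_ge_2_nat)
  have V0: "0 \<le> V" unfolding V_def S_def
    by (intro prod_nonneg) (use p2 in fastforce)
  have "prime_factors N = R \<union> S" "R \<inter> S = {}" by (auto simp: R_def S_def)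
  moreover have finR: "finite R" "finite S" by (auto simp: R_def S_def)
  ultimately have "(\<Prod>p\<in>prime_factors N. 1 - 1 / real p) = (\<Prod>p\<in>R. 1 - 1 / real p) * V"
    by (simp add: V_def prod.union_disjoint)
  then have tot: "real (totient N) / real N = (\<Prod>p\<in>R. 1 - 1 / real p) * V"
    using N by (simp add: totient_formula2)
  have "(\<Sum>p\<in>R. 1 / real p) \<le> (\<Sum>p\<in>R. 1 / (4 * L ^ 2))"
  proof (rule sum_mono)
    fix p assume "p \<in> R"
    then have "4 * L ^ 2 < real p" by (auto simp: R_def S_def L_def)
    then show "1 / real p \<le> 1 / (4 * L ^ 2)" using L1 by (intro frac_le) auto
  qed
  also have "\<dots> = real (card R) / (4 * L ^ 2)" by simp
  also have "\<dots> \<le> 2 * L / (4 * L ^ 2)"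
  proof (rule divide_right_mono)
    have "card R \<le> card (prime_factors N)" by (intro card_mono) (auto simp: R_def)
    then show "real (card R) \<le> 2 * L" using card_prime_factors_le[OF N] by (simp add: L_def)
  qed simp
  also have "\<dots> = 1 / (2 * L)" using L1 by (simp add: power2_eq_square)
  finally have "1 - 1 / (2 * L) \<le> 1 - (\<Sum>p\<in>R. 1 / real p)" by simp
  also have "\<dots> \<le> (\<Prod>p\<in>R. 1 - 1 / real p)"
  proof (rule prod_one_minus_ge[OF finR(1)])
    show "0 \<le> 1 / real p \<and> 1 / real p \<le> 1" if "p \<in> R" for p
      using that p2[of p] by (auto simp: R_def)
  qed
  finally have R: "1 - 1 / (2 * L) \<le> (\<Prod>p\<in>R. 1 - 1 / real p)" .
  have V: "(1 - 1 / (2 * L)) * V \<le> real (totient N) / real N"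
    unfolding tot by (rule mult_right_mono[OF R V0])
  have "1 / (2 * L) \<le> 1 / 2" using L1 by (simp add: field_simps)
  then have "1 / 2 * V \<le> (1 - 1 / (2 * L)) * V" using V0 by (intro mult_right_mono) auto
  with V show "real (totient N) / real N \<ge> V / 2" by linarith
  have "V \<le> (1 - 1 / (2 * L)) * V * (1 + 1 / L)"
  proof -
    \<comment> \<open>With \<open>x = 1 / L\<close>, which is at most 1, the product is
      \<open>1 + x * (1 - x) / 2\<close>.\<close>
    have "1 \<le> (1 - 1 / (2 * L)) * (1 + 1 / L)"
      using L1 by (simp add: field_simps)
    then show ?thesis using V0 mult_right_mono[of 1 "(1 - 1 / (2 * L)) * (1 + 1 / L)" V]
      by (simp add: mult_ac)
  qed
  also have "\<dots> \<le> real (totient N) / real N * (1 + 1 / L)"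
    using V L1 by (intro mult_right_mono) auto
  finally show "V \<le> real (totient N) / real N * (1 + 1 / L)" .
qed

text \<open>The sieve is run with \<open>k\<close> between \<open>4 * l\<close> and about
  \<open>6 * l\<close>: large enough for \<open>2 ^ k\<close> to reach \<open>L ^ 2\<close>, small
  enough for the number of subsets to stay below \<open>exp (12 * l ^ 2 + 1)\<close>. The conditions
  \<open>a1\<close> and \<open>a2\<close>, valid for all large \<open>N\<close>, make the truncation
  and rounding errors each a \<open>1 / L\<close> fraction of the main term.\<close>

lemma coprime_count_bound:
  fixes N :: nat and L l :: real
  defines "L \<equiv> ln (real N)" and "l \<equiv> ln (ln (real N))"
  assumes l4: "5 \<le> l" and a1: "32000 * l ^ 3 \<le> L" and a2: "80 * l * L * exp (12 * l ^ 2 + 1) \<le> exp (15 * l ^ 2)"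
  shows "real N \<le> 80 * l * real (totient N)"
    and "exp (15 * l ^ 2) \<le> h \<Longrightarrow>
      real (card {b::int. \<bar>real_of_int b - u\<bar> \<le> h \<and> coprime b (int N)})
        \<le> 2 * h * (real (totient N) / real N) * (1 + 3 / L)"
proof -
  have "1 \<le> 32000 * l ^ 3" using l4 one_le_power[of l 3] by linarith
  then have L1: "1 \<le> L" using a1 by linarith
  have Ll: "L = exp l" using L1 by (simp add: L_def l_def)
  have N: "1 \<le> N" using L1 by (cases "N = 0") (auto simp: L_def)
  define S where "S = {p \<in> prime_factors N. real p \<le> 4 * L ^ 2}"
  define V where "V = (\<Prod>p\<in>S. 1 - 1 / real p)"
  define W where "W = (\<Prod>p\<in>S. 1 + 1 / real p)"
  define \<phi> where "\<phi> = real (totient N) / real N"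
  note small = totient_small_primes[of N, folded L_def, OF L1, folded S_def, folded V_def \<phi>_def]
  have fin: "finite S" by (simp add: S_def)
  have prS: "prime p" if "p \<in> S" for p using that by (auto simp: S_def in_prime_factors_iff)
  have V0: "0 \<le> V" unfolding V_def
    by (intro prod_nonneg) (auto dest!: prS prime_ge_1_nat)
  have W0: "0 \<le> W" unfolding W_def by (intro prod_nonneg) auto
  define n where "n = nat \<lfloor>4 * L ^ 2\<rfloor>"
  have "1 \<le> 4 * L ^ 2" using L1 one_le_power[of L 2] by linarith
  then have n1: "1 \<le> n" and nL: "real n \<le> 4 * L ^ 2" by (auto simp: n_def le_nat_floor)
  have Sn: "prime p \<and> p \<le> n" if "p \<in> S" for p
    using prS[OF that] that by (auto simp: S_def n_def le_nat_floor)
  have W20: "W \<le> 20 * l"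
  proof -
    have "W \<le> 2 * (1 + 4 * ln (real n))"
      unfolding W_def by (rule prod_one_plus_inverse_primes_le[OF n1 Sn])
    moreover have "ln (real n) \<le> 2 + 2 * l"
    proof -
      have "ln (real n) \<le> ln (4 * L ^ 2)" using n1 nL by (intro ln_mono) auto
      also have "\<dots> = ln ((2 * L) ^ 2)" by (simp add: power_mult_distrib)
      also have "\<dots> = 2 * ln 2 + 2 * ln L" using L1 by (simp only: ln_realpow ln_mult_pos) (simp add: ln_realpow ln_mult)
      also have "\<dots> \<le> 2 * 1 + 2 * ln L"
        using ln_2_less_1 by (intro add_mono mult_left_mono) auto
      finally show ?thesis using Ll by simp
    qed
    ultimately show ?thesis using l4 by simp
  qed
  \<comment> \<open>The bound \<open>W \<le> 20 * l\<close> becomes a lower bound for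
    \<open>V\<close>, and with a further factor 2 for \<open>\<phi>\<close>.\<close>
  have "1 \<le> 2 * W * V" unfolding W_def V_def by (rule one_le_prod_one_minus_inverse_primes[OF n1 Sn])
  also have "\<dots> \<le> 40 * l * V" using W20 V0 by (intro mult_right_mono) auto
  also have "\<dots> \<le> 40 * l * (2 * \<phi>)" using small(2) l4 by (intro mult_left_mono) auto
  finally have phi: "1 \<le> 80 * l * \<phi>" by simp
  then show "real N \<le> 80 * l * real (totient N)" using N by (simp add: \<phi>_def field_simps)
  have phi0: "0 \<le> \<phi>" by (simp add: \<phi>_def)
  show "real (card {b::int. \<bar>real_of_int b - u\<bar> \<le> h \<and> coprime b (int N)})
        \<le> 2 * h * (real (totient N) / real N) * (1 + 3 / L)" if h: "exp (15 * l ^ 2) \<le> h"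
  proof -
    have h0: "0 \<le> h" using h exp_ge_zero order.trans by blast
    define m where "m = nat \<lceil>2 * l\<rceil>"
    define k where "k = 2 * m"
    have m: "2 * l \<le> real m" "real m \<le> 3 * l" using l4 unfolding m_def by linarith+
    have k2: "L ^ 2 \<le> 2 ^ k"
    proof -
      have "L ^ 2 = exp (2 * l)" unfolding Ll by (simp add: exp_double)
      also have "\<dots> \<le> exp (real m)" using m by simp
      also have "\<dots> = exp 1 ^ m" by (simp add: exp_of_nat_mult[symmetric])
      also have "\<dots> \<le> 4 ^ m" using exp_le by (intro power_mono) auto
      also have "\<dots> = 2 ^ k" by (simp add: k_def power_mult)
      finally show ?thesis .
    qed
    have "card {b::int. \<bar>real_of_int b - u\<bar> \<le> h \<and> coprime b (int N)}
       \<le> card {b::int. \<bar>real_of_int b - u\<bar> \<le> h \<and> (\<forall>p\<in>S. \<not> int p dvd b)}"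
    proof (rule card_mono)
      show "finite {b::int. \<bar>real_of_int b - u\<bar> \<le> h \<and> (\<forall>p\<in>S. \<not> int p dvd b)}"
        by (rule finite_subset[OF _ finite_int_interval[of u h]]) auto
      have False if "coprime b (int N)" "p \<in> S" "int p dvd b" for p b
      proof -
        have "int p dvd int N" using that(2) by (auto simp: S_def in_prime_factors_iff)
        then have "is_unit (int p)" using that coprime_common_divisor by blast
        then show False using prS[OF that(2)] by (simp add: prime_nat_iff)
      qed
      then show "{b::int. \<bar>real_of_int b - u\<bar> \<le> h \<and> coprime b (int N)}
        \<subseteq> {b::int. \<bar>real_of_int b - u\<bar> \<le> h \<and> (\<forall>p\<in>S. \<not> int p dvd b)}" by blast
    qed
    then have "real (card {b::int. \<bar>real_of_int b - u\<bar> \<le> h \<and> coprime b (int N)})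
       \<le> real (card {b::int. \<bar>real_of_int b - u\<bar> \<le> h \<and> (\<forall>p\<in>S. \<not> int p dvd b)})" by simp
    also have "\<dots> \<le> 2 * h * (V + W ^ 2 / 2 ^ k) + real (card {A. A \<in> Pow S \<and> card A \<le> k})"
      unfolding V_def W_def by (rule brun_pure_sieve[OF fin prS _ h0]) (simp_all add: k_def)
    also have "\<dots> \<le> 2 * h * (\<phi> * (1 + 1 / L) + \<phi> / L) + 2 * h * (\<phi> / L)"
    proof (intro add_mono mult_left_mono)
      show "V \<le> \<phi> * (1 + 1 / L)" by (rule small(1))
      have "W ^ 2 / 2 ^ k \<le> (20 * l) ^ 2 / L ^ 2"
        using W20 W0 k2 L1 by (intro frac_le power_mono) auto
      also have "\<dots> \<le> \<phi> / L"
      proof -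
        \<comment> \<open>The constant 32000 in \<open>a1\<close> is
          \<open>20 ^ 2 * 80\<close>.\<close>
        have "(20 * l) ^ 2 * 1 \<le> (20 * l) ^ 2 * (80 * l * \<phi>)"
          by (rule mult_left_mono[OF phi]) simp
        also have "\<dots> = (32000 * l ^ 3) * \<phi>" by (simp add: power2_eq_square power3_eq_cube)
        also have "\<dots> \<le> L * \<phi>" by (rule mult_right_mono[OF a1 phi0])
        finally have "(20 * l) ^ 2 / L ^ 2 \<le> L * \<phi> / L ^ 2" by (intro divide_right_mono) auto
        then show ?thesis using L1 by (simp add: power2_eq_square)
      qed
      finally show "W ^ 2 / 2 ^ k \<le> \<phi> / L" .
      have "real (card {A. A \<in> Pow S \<and> card A \<le> k}) \<le> (2 * L) ^ k * exp 1"
      proof (rule card_small_subsets_le[OF fin])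
        have "card S \<le> card (prime_factors N)" by (intro card_mono) (auto simp: S_def)
        then show "real (card S) \<le> 2 * L" using card_prime_factors_le[OF N] by (simp add: L_def)
      qed (use L1 in simp)
      \<comment> \<open>Together with \<open>k \<le> 6 * l\<close>, the base
        \<open>exp (2 * l)\<close> produces the exponent \<open>12 * l ^ 2\<close>.\<close>
      also have "(2 * L) ^ k \<le> exp (2 * l) ^ k"
      proof (rule power_mono)
        have "2 \<le> exp l" using l4 exp_ge_add_one_self[of l] by linarith
        then have "2 * exp l \<le> exp l * exp l" by simp
        then show "2 * L \<le> exp (2 * l)" unfolding Ll by (simp add: mult_exp_exp)
      qed (use L1 in simp)
      also have "exp (2 * l) ^ k = exp (real k * (2 * l))" by (simp add: exp_of_nat_mult)
      also have "\<dots> \<le> exp (12 * l ^ 2)"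
      proof -
        have "real k * (2 * l) \<le> (6 * l) * (2 * l)" using m l4 by (intro mult_right_mono) (auto simp: k_def)
        then show ?thesis by (simp add: power2_eq_square)
      qed
      finally have "real (card {A. A \<in> Pow S \<and> card A \<le> k}) \<le> exp (12 * l ^ 2) * exp 1" by simp
      also have "\<dots> = exp (12 * l ^ 2 + 1)" by (simp add: exp_add)
      \<comment> \<open>The rounding error does not scale with \<open>h\<close>; the lower bounds on
        \<open>\<phi>\<close> and \<open>h\<close> bring it into the shape of the main term.\<close>
      also have "\<dots> \<le> exp (12 * l ^ 2 + 1) * (80 * l * \<phi>)"
        using mult_left_mono[OF phi, of "exp (12 * l ^ 2 + 1)"] by simp
      also have "\<dots> = (80 * l * L * exp (12 * l ^ 2 + 1)) * (\<phi> / L)" using L1 by simp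
      also have "\<dots> \<le> exp (15 * l ^ 2) * (\<phi> / L)"
        using a2 phi0 L1 by (intro mult_right_mono) auto
      also have "\<dots> \<le> (2 * h) * (\<phi> / L)"
        using h h0 phi0 L1 by (intro mult_right_mono) auto
      finally show "real (card {A. A \<in> Pow S \<and> card A \<le> k}) \<le> 2 * h * (\<phi> / L)" by simp
    qed (use h0 in auto)
    also have "\<dots> = 2 * h * \<phi> * (1 + 3 / L)" by (simp add: algebra_simps)
    finally show ?thesis by (simp add: \<phi>_def)
  qed
qed


section \<open>Counting the approximable units\<close>

text \<open>A union bound over the reduced fractions \<open>p / q\<close> in the closed unit
  interval. The count \<open>U\<close> per interval is left open so that the sieve and the trivial
  count can be used in different ranges of \<open>q\<close>.\<close>

lemma card_approximable_units_le:
  fixes N :: nat and T :: real and U :: "nat \<Rightarrow> real"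
  defines "n \<equiv> nat \<lfloor>sqrt (real N / T)\<rfloor>"
  assumes N: "1 \<le> N" and T: "1 < T"
    and U: "\<And>q u. q \<in> {1..n} \<Longrightarrow>
      real (card {b::int. \<bar>real_of_int b - u\<bar> \<le> real N / T / real q ^ 2 \<and> coprime b (int N)}) \<le> U q"
  shows "real (card (approximable_units N T))
    \<le> (\<Sum>q=1..n. (real (totient q) + (if q = 1 then 1 else 0)) * U q)"
proof -
  \<comment> \<open>As \<open>totatives 1\<close> is \<open>{1}\<close>, the numerator 0 has to be
    added for \<open>q = 1\<close>; it stands for the units close to 0.\<close>
  define P where "P q = int ` totatives q \<union> (if q = 1 then {0} else {})" for q
  define J where "J q p = {b::int. \<bar>real_of_int b - real_of_int p * real N / real q\<bar> \<le> real N / T / real q ^ 2 \<and> coprime b (int N)}" for q :: nat and p :: int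
  have finP: "finite (P q)" for q by (auto simp: P_def)
  have finJ: "finite (J q p)" for q p
    unfolding J_def by (rule finite_subset[OF _ finite_int_interval]) auto
  have cardP: "real (card (P q)) \<le> real (totient q) + (if q = 1 then 1 else 0)" for q
  proof -
    have "card (P q) \<le> card (int ` totatives q) + card (if q = 1 then {0 :: int} else {})"
      unfolding P_def by (rule card_Un_le)
    also have "card (int ` totatives q) = totient q"
      by (simp add: totient_def card_image)
    finally show ?thesis by (auto split: if_splits)
  qed
  have sub: "int ` approximable_units N T \<subseteq> (\<Union>q\<in>{1..n}. \<Union>p\<in>P q. J q p)"
  proof
    fix x assume "x \<in> int ` approximable_units N T"
    then obtain b where b: "x = int b" "b \<in> approximable_units N T" by auto
    then obtain q :: nat and p :: int where h: "0 < q" "coprime p (int q)" "real q ^ 2 * T \<le> real N"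
        "\<bar>real b * real q - real_of_int p * real N\<bar> * real q * T \<le> real N"
        and bu: "1 \<le> b" "b \<le> N" "coprime b N"
      by (auto simp: approximable_units_def unit_residues_def)
    have "real q ^ 2 \<le> real N / T" using h(3) T by (simp add: field_simps)
    then have "real q \<le> sqrt (real N / T)" by (rule real_le_rsqrt)
    then have qn: "q \<in> {1..n}" using h(1) by (simp add: n_def le_nat_floor)
    define y where "y = \<bar>real b * real q - real_of_int p * real N\<bar>"
    have q1: "1 \<le> real q" using h(1) by simp
    \<comment> \<open>Strictness, from \<open>1 < T\<close>, forces \<open>p\<close> strictly
      between \<open>-1\<close> and \<open>q + 1\<close>.\<close>
    have yN: "y < real N"
    proof (rule ccontr)
      assume "\<not> y < real N"
      then have "real N * 1 * T \<le> y * real q * T" using q1 T by (intro mult_mono) (auto simp: y_def)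
      moreover have "real N * 1 < real N * T" using N T by (intro mult_strict_left_mono) auto
      ultimately show False using h(4) by (simp add: y_def)
    qed
    have "p \<in> P q"
    proof -
      have "0 < real b * real q" using bu q1 by simp
      then have "- real N < real_of_int p * real N" using yN by (auto simp: y_def)
      then have "real N * (-1) < real N * real_of_int p" by (simp add: mult.commute)
      then have "-1 < real_of_int p" using N by (subst (asm) mult_less_cancel_left_pos) auto
      then have p0: "0 \<le> p" by linarith
      have "real b * real q \<le> real N * real q" using bu by (intro mult_right_mono) auto
      then have "real_of_int p * real N < real N * real q + real N" using yN by (auto simp: y_def)
      then have "real N * real_of_int p < real N * (real q + 1)" by (simp add: algebra_simps)
      then have "real_of_int p < real q + 1" using N by (subst (asm) mult_less_cancel_left_pos) auto
      then have pq: "p \<le> int q" by linarith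
      show ?thesis
      proof (cases "p = 0")
        case True
        then show ?thesis using h(2) by (auto simp: P_def)
      next
        case False
        have "p = int (nat p)" using p0 by simp
        moreover have "nat p \<in> totatives q"
        proof -
          have "coprime (int (nat p)) (int q)" using h(2) p0 by simp
          then have "coprime (nat p) q" by (simp only: coprime_int_iff)
          then show ?thesis using False p0 pq by (auto simp: totatives_def)
        qed
        ultimately show ?thesis unfolding P_def by blast
      qed
    qed
    moreover have "x \<in> J q p"
    proof -
      have "real_of_int (int b) - real_of_int p * real N / real q = (real b * real q - real_of_int p * real N) / real q"
        using q1 by (simp add: field_simps)
      then have "\<bar>real_of_int (int b) - real_of_int p * real N / real q\<bar> = y / real q"
        by (simp add: y_def)
      also have "\<dots> \<le> real N / T / real q ^ 2"
        using h(4) q1 T by (simp add: y_def[symmetric] field_simps power2_eq_square)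
      finally show ?thesis using bu(3) by (simp add: J_def b coprime_int_iff)
    qed
    ultimately show "x \<in> (\<Union>q\<in>{1..n}. \<Union>p\<in>P q. J q p)" using qn by blast
  qed
  have "card (approximable_units N T) = card (int ` approximable_units N T)"
    by (simp add: card_image)
  also have "\<dots> \<le> card (\<Union>q\<in>{1..n}. \<Union>p\<in>P q. J q p)"
    using finP finJ by (intro card_mono sub) auto
  also have "\<dots> \<le> (\<Sum>q=1..n. card (\<Union>p\<in>P q. J q p))" by (rule card_UN_le) simp
  also have "\<dots> \<le> (\<Sum>q=1..n. \<Sum>p\<in>P q. card (J q p))"
    by (intro sum_mono card_UN_le finP)
  finally have "real (card (approximable_units N T)) \<le> real (\<Sum>q=1..n. \<Sum>p\<in>P q. card (J q p))"
    by (rule of_nat_mono)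
  also have "\<dots> = (\<Sum>q=1..n. \<Sum>p\<in>P q. real (card (J q p)))" by simp
  also have "\<dots> \<le> (\<Sum>q=1..n. (real (totient q) + (if q = 1 then 1 else 0)) * U q)"
  proof (rule sum_mono)
    fix q assume q: "q \<in> {1..n}"
    have U0: "0 \<le> U q" using U[OF q, of 0] by (meson of_nat_0_le_iff order.trans)
    have "(\<Sum>p\<in>P q. real (card (J q p))) \<le> real (card (P q)) * U q"
      using U[OF q] by (intro sum_bounded_above) (auto simp: J_def)
    also have "\<dots> \<le> (real (totient q) + (if q = 1 then 1 else 0)) * U q"
      by (rule mult_right_mono[OF cardP U0])
    finally show "(\<Sum>p\<in>P q. real (card (J q p))) \<le> (real (totient q) + (if q = 1 then 1 else 0)) * U q" .
  qed
  finally show ?thesis .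
qed

lemma sum_inverse_above_le:
  fixes E Y :: real
  assumes "1 \<le> E" "0 < Y"
  shows "(\<Sum>q | q \<in> {1..nat \<lfloor>Y\<rfloor>} \<and> Y / E < real q. 1 / real q) \<le> 1 + ln E"
proof -
  define n m where "n = nat \<lfloor>Y\<rfloor>" and "m = nat \<lfloor>Y / E\<rfloor>"
  have nY: "real n \<le> Y" using assms by (simp add: n_def)
  have mY: "Y / E < real m + 1" by (simp add: m_def) linarith
  have "(\<Sum>q | q \<in> {1..n} \<and> Y / E < real q. 1 / real q) \<le> (\<Sum>q\<in>{m<..n}. 1 / real q)"
  proof (rule sum_mono2)
    show "{q. q \<in> {1..n} \<and> Y / E < real q} \<subseteq> {m<..n}"
    proof
      fix q assume q: "q \<in> {q. q \<in> {1..n} \<and> Y / E < real q}"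
      have "real m \<le> Y / E" using assms by (simp add: m_def)
      then show "q \<in> {m<..n}" using q by auto
    qed
  qed auto
  also have "\<dots> \<le> 1 + ln E"
  proof (cases "m < n")
    case True
    \<comment> \<open>The first term is split off because \<open>m\<close> may be 0, and because
      \<open>Y / E\<close> is below \<open>m + 1\<close> but not necessarily below
      \<open>m\<close>.\<close>
    then have "{m<..n} = insert (m + 1) {m + 1<..n}" by auto
    then have "(\<Sum>q\<in>{m<..n}. 1 / real q) = 1 / real (m + 1) + (\<Sum>q\<in>{m + 1<..n}. 1 / real q)" by simp
    also have "\<dots> \<le> 1 + ln (real n / real (m + 1))"
      using True by (intro add_mono sum_inverse_le_ln) auto
    also have "ln (real n / real (m + 1)) \<le> ln E"
    proof (rule ln_mono)
      have "Y \<le> E * (real m + 1)" using mY assms by (simp add: field_simps)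
      then show "real n / real (m + 1) \<le> E" using nY by (simp add: field_simps)
      show "0 < real n / real (m + 1)" using True by simp
    qed
    finally show ?thesis by simp
  qed (use assms in simp)
  finally show ?thesis by (simp add: n_def)
qed

text \<open>For \<open>q \<le> Y / E\<close> the half-length \<open>(Y / q) ^ 2\<close> is at least
  \<open>E\<close>, so the sieve bound applies and the weights sum to
  \<open>totient_square_sum n\<close>. For larger \<open>q\<close> the trivial count is used, and
  \<open>1 / q\<close> sums to at most \<open>1 + ln E\<close>. The constant
  \<open>6 / pi ^ 2\<close> is halved because \<open>n \<le> sqrt N\<close>.\<close>

lemma card_approximable_units_asymp_le:
  fixes N :: nat and T c L l :: real
  defines "L \<equiv> ln (real N)" and "l \<equiv> ln (ln (real N))"
  assumes l5: "5 \<le> l" and a1: "32000 * l ^ 3 \<le> L" and a2: "80 * l * L * exp (12 * l ^ 2 + 1) \<le> exp (15 * l ^ 2)"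
    and T: "1 < T" and c: "0 \<le> c" "\<And>n. 1 \<le> n \<Longrightarrow> totient_square_sum n \<le> 6 / pi ^ 2 * ln (real n) + c"
  shows "real (card (approximable_units N T))
    \<le> 2 * real (totient N) / T * (1 + 3 / L) * (3 / pi ^ 2 * L + c + 1) + 6 * real N / T * (1 + 15 * l ^ 2)"
proof -
  note bounds = coprime_count_bound[of N, folded L_def l_def, OF l5 a1 a2]
  have "1 \<le> 32000 * l ^ 3" using l5 one_le_power[of l 3] by linarith
  then have L1: "1 \<le> L" using a1 by linarith
  have N: "1 \<le> N" using L1 by (cases "N = 0") (auto simp: L_def)
  define X where "X = real N / T"
  have X0: "0 < X" using N T by (simp add: X_def)
  define Y where "Y = sqrt X"
  have Y0: "0 < Y" and YX: "Y ^ 2 = X" using X0 by (auto simp: Y_def)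
  define n where "n = nat \<lfloor>Y\<rfloor>"
  have nY: "real n \<le> Y" using Y0 by (simp add: n_def)
  define E where "E = exp (15 * l ^ 2)"
  have E1: "1 \<le> E" by (simp add: E_def)
  define \<phi> where "\<phi> = real (totient N) / real N"
  have phi0: "0 \<le> \<phi>" by (simp add: \<phi>_def)
  define g where "g = 2 * \<phi> * (1 + 3 / L)"
  have g0: "0 \<le> g" using phi0 L1 by (simp add: g_def)
  define w where "w q = real (totient q) + (if q = 1 then 1 else 0)" for q :: nat
  define U where "U q = X / real q ^ 2 * (if real q \<le> Y / E then g else 3)" for q :: nat
  have "real (card (approximable_units N T)) \<le> (\<Sum>q=1..n. w q * U q)"
    unfolding w_def n_def Y_def X_def
  proof (rule card_approximable_units_le[OF N T], fold X_def, fold Y_def, fold n_def)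
    fix q u assume "q \<in> {1..n}"
    then have q: "1 \<le> real q" "real q \<le> Y" using nY by auto
    define h where "h = X / real q ^ 2"
    have h: "h = (Y / real q) ^ 2" by (simp add: h_def YX[symmetric] power_divide)
    show "real (card {b::int. \<bar>real_of_int b - u\<bar> \<le> X / real q ^ 2 \<and> coprime b (int N)}) \<le> U q"
    proof (cases "real q \<le> Y / E")
      case True
      then have "E \<le> Y / real q" using q E1 by (simp add: field_simps)
      also have "\<dots> = (Y / real q) * 1" by simp
      also have "\<dots> \<le> (Y / real q) * (Y / real q)" using q by (intro mult_left_mono) auto
      finally have "exp (15 * l ^ 2) \<le> h" by (simp add: h E_def power2_eq_square)
      from bounds(2)[OF this, of u] show ?thesis
        using True by (simp add: U_def h_def g_def \<phi>_def mult_ac)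
    next
      case False
      have "1 \<le> Y / real q" using q by simp
      then have h1: "1 \<le> h" unfolding h by (rule one_le_power)
      have "real (card {b::int. \<bar>real_of_int b - u\<bar> \<le> h \<and> coprime b (int N)})
         \<le> real (card {b::int. \<bar>real_of_int b - u\<bar> \<le> h \<and> int 1 dvd b})"
        by (intro of_nat_mono card_mono finite_subset[OF _ finite_int_interval[of u h]]) auto
      \<comment> \<open>With \<open>d = 1\<close> the count of multiples is a count of all
        integers.\<close>
      also have "\<dots> \<le> 2 * h + 1"
        using card_multiples_in_interval[of 1 h u] h1 by simp
      also have "\<dots> \<le> 3 * h" using h1 by simp
      finally show ?thesis using False by (simp add: U_def h_def mult.commute)
    qed
  qed
  also have "\<dots> \<le> (\<Sum>q=1..n. X * g * (real (totient q) / real q ^ 2 + (if q = 1 then 1 else 0))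
      + (if Y / E < real q then 6 * X * (1 / real q) else 0))"
  proof (rule sum_mono)
    fix q assume "q \<in> {1..n}"
    then have q: "1 \<le> q" by simp
    have w: "w q / real q ^ 2 = real (totient q) / real q ^ 2 + (if q = 1 then 1 else 0)"
      by (simp add: w_def add_divide_distrib)
    show "w q * U q \<le> X * g * (real (totient q) / real q ^ 2 + (if q = 1 then 1 else 0))
        + (if Y / E < real q then 6 * X * (1 / real q) else 0)"
    proof (cases "Y / E < real q")
      case False
      then have "w q * U q = X * g * (w q / real q ^ 2)" by (simp add: U_def)
      then show ?thesis using False by (simp add: w)
    next
      case True
      have "w q \<le> 2 * real q"
        using q totient_le[of q] by (auto simp: w_def)
      then have "w q * (3 * X / real q ^ 2) \<le> (2 * real q) * (3 * X / real q ^ 2)"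
        using X0 by (intro mult_right_mono) auto
      also have "\<dots> = 6 * X * (1 / real q)" using q by (simp add: field_simps power2_eq_square)
      also have "w q * (3 * X / real q ^ 2) = w q * U q" using True by (simp add: U_def)
      finally have "w q * U q \<le> 6 * X * (1 / real q)" .
      moreover have "0 \<le> X * g * (real (totient q) / real q ^ 2 + (if q = 1 then 1 else 0))"
        using X0 g0 by (intro mult_nonneg_nonneg add_nonneg_nonneg) auto
      ultimately show ?thesis using True by simp
    qed
  qed
  also have "\<dots> = X * g * (totient_square_sum n + (\<Sum>q=1..n. if q = 1 then 1 else 0))
      + 6 * X * (\<Sum>q | q \<in> {1..n} \<and> Y / E < real q. 1 / real q)"
  proof -
    have "(\<Sum>q=1..n. if Y / E < real q then 6 * X * (1 / real q) else 0)
       = (\<Sum>q | q \<in> {1..n} \<and> Y / E < real q. 6 * X * (1 / real q))"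
      by (rule sum.inter_filter[symmetric]) simp
    then show ?thesis
      by (simp only: sum.distrib totient_square_sum_def sum_distrib_left[symmetric])
  qed
  also have "\<dots> \<le> X * g * (3 / pi ^ 2 * L + c + 1) + 6 * X * (1 + 15 * l ^ 2)"
  proof (intro add_mono mult_left_mono)
    show "totient_square_sum n \<le> 3 / pi ^ 2 * L + c"
    proof (cases "1 \<le> n")
      case True
      have "ln (real n) \<le> ln (sqrt (real N))"
      proof (rule ln_mono)
        have "X \<le> real N / 1" unfolding X_def using T by (intro divide_left_mono) auto
        then show "real n \<le> sqrt (real N)" using nY by (simp add: Y_def) (meson order.trans real_sqrt_le_mono)
      qed (use True in simp)
      also have "\<dots> = L / 2" using N by (simp add: ln_sqrt L_def)
      finally have "6 / pi ^ 2 * ln (real n) \<le> 6 / pi ^ 2 * (L / 2)" by (intro mult_left_mono) auto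
      then show ?thesis using c(2)[OF True] by simp
    next
      case False
      then show ?thesis using c(1) L1 by (simp add: totient_square_sum_def)
    qed
    show "(\<Sum>q=1..n. if q = 1 then 1 else 0) \<le> (1 :: real)" by simp
    show "(\<Sum>q | q \<in> {1..n} \<and> Y / E < real q. 1 / real q) \<le> 1 + 15 * l ^ 2"
      using sum_inverse_above_le[OF E1 Y0] by (simp add: n_def E_def)
  qed (use X0 g0 in auto)
  also have "X * g = 2 * real (totient N) / T * (1 + 3 / L)"
    using N by (simp add: X_def g_def \<phi>_def)
  finally show ?thesis by (simp add: X_def)
qed

section \<open>The final bound, for large and for small \<open>N\<close>\<close>

text \<open>The constant 12 is \<open>2 * 2 * 3\<close>: one 2 for inversion, one for the two sides
  of each interval, and 3 from \<open>3 / pi ^ 2\<close>. Replacing \<open>N\<close> by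
  \<open>80 * l * totient N\<close> in the second term raises \<open>l ^ 2\<close> to
  \<open>l ^ 3\<close>.\<close>

lemma large_quotient_proportion_le:
  fixes N :: nat and t c L l :: real
  defines "L \<equiv> ln (real N)" and "l \<equiv> ln (ln (real N))"
  assumes l5: "5 \<le> l" and a1: "32000 * l ^ 3 \<le> L" and a2: "80 * l * L * exp (12 * l ^ 2 + 1) \<le> exp (15 * l ^ 2)"
    and t: "1 \<le> t" and c: "0 \<le> c" "\<And>n. 1 \<le> n \<Longrightarrow> totient_square_sum n \<le> 6 / pi ^ 2 * ln (real n) + c"
  shows "1 / real (totient N)
      * real (card {a \<in> unit_residues N. t * L \<le> real (max_partial_quotient (real a / real N))})
    \<le> 12 / (pi ^ 2 * t) + (16 * c + 16000) * (l ^ 3 / (t * L))"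
proof -
  have l3: "1 \<le> l ^ 3" "1 + 15 * l ^ 2 \<le> 16 * l ^ 2" using l5 by (auto intro: one_le_power)
  then have L3: "3 \<le> L" using a1 by linarith
  have N: "2 \<le> N"
  proof (rule ccontr)
    assume "\<not> 2 \<le> N"
    then have "N = 0 \<or> N = 1" by auto
    then show False using L3 by (auto simp: L_def)
  qed
  define T where "T = t * L"
  have T: "1 < T" using t L3 mult_mono[of 1 t 3 L] by (simp add: T_def)
  define F where "F = real (totient N)"
  have F0: "0 < F" using N by (simp add: F_def totient_gt_0_iff)
  have "real (card {a \<in> unit_residues N. T \<le> real (max_partial_quotient (real a / real N))})
      \<le> real (2 * card (approximable_units N T))"
    using T by (intro of_nat_mono card_large_quotient_le N) auto
  also have "\<dots> \<le> 2 * (2 * F / T * (1 + 3 / L) * (3 / pi ^ 2 * L + c + 1) + 6 * real N / T * (1 + 15 * l ^ 2))"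
    using card_approximable_units_asymp_le[of N, folded L_def l_def, OF l5 a1 a2 T c] by (simp add: F_def)
  also have "\<dots> \<le> 2 * (2 * F / T * (3 / pi ^ 2 * L + (2 * c + 5)) + 6 * (80 * l * F) / T * (16 * l ^ 2))"
  proof (rule mult_left_mono[OF add_mono])
    have "(1 + 3 / L) * (3 / pi ^ 2 * L + c + 1) = 3 / pi ^ 2 * L + (c + 1) + 9 / pi ^ 2 + 3 / L * (c + 1)"
      using L3 by (simp add: field_simps)
    moreover have "9 / pi ^ 2 \<le> 1" using pi_gt3 power_mono[of 3 pi 2] by simp
    moreover have "3 / L * (c + 1) \<le> 1 * (c + 1)" using L3 c by (intro mult_right_mono) auto
    ultimately have "(1 + 3 / L) * (3 / pi ^ 2 * L + c + 1) \<le> 3 / pi ^ 2 * L + (c + 1) + 1 + 1 * (c + 1)"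
      by (simp only: add_mono order.refl)
    also have "\<dots> \<le> 3 / pi ^ 2 * L + (2 * c + 5)" by simp
    finally have "(1 + 3 / L) * (3 / pi ^ 2 * L + c + 1) \<le> 3 / pi ^ 2 * L + (2 * c + 5)" .
    then have "2 * F / T * ((1 + 3 / L) * (3 / pi ^ 2 * L + c + 1)) \<le> 2 * F / T * (3 / pi ^ 2 * L + (2 * c + 5))"
      using F0 T by (intro mult_left_mono) auto
    then show "2 * F / T * (1 + 3 / L) * (3 / pi ^ 2 * L + c + 1) \<le> 2 * F / T * (3 / pi ^ 2 * L + (2 * c + 5))"
      by (simp add: mult.assoc)
    have "real N \<le> 80 * l * F"
      using coprime_count_bound(1)[of N, folded L_def l_def, OF l5 a1 a2] by (simp add: F_def)
    then have "6 * real N / T \<le> 6 * (80 * l * F) / T"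
      using T by (intro divide_right_mono mult_left_mono) auto
    then show "6 * real N / T * (1 + 15 * l ^ 2) \<le> 6 * (80 * l * F) / T * (16 * l ^ 2)"
      using l3(2) l5 F0 T by (intro mult_mono) auto
  qed simp
  \<comment> \<open>Here \<open>8 * c + 20 = 4 * (2 * c + 5)\<close> and
    \<open>15360 = 2 * 6 * 80 * 16\<close>.\<close>
  also have "\<dots> = F * (12 / (pi ^ 2 * t) + (8 * c + 20 + 15360 * l ^ 3) / T)"
    using T L3 t by (simp add: T_def field_simps power2_eq_square power3_eq_cube)
  also have "\<dots> \<le> F * (12 / (pi ^ 2 * t) + (16 * c + 16000) * l ^ 3 / T)"
  proof (intro mult_left_mono add_left_mono divide_right_mono)
    have "(8 * c + 20) * 1 \<le> (8 * c + 20) * l ^ 3" using c l3 by (intro mult_left_mono) auto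
    moreover have "0 \<le> (8 * c + 620) * l ^ 3" using c(1) l5 by (intro mult_nonneg_nonneg) auto
    ultimately show "8 * c + 20 + 15360 * l ^ 3 \<le> (16 * c + 16000) * l ^ 3" by (simp add: algebra_simps)
  qed (use F0 T in auto)
  finally show ?thesis using F0 by (simp add: F_def T_def field_simps)
qed

lemma card_unit_residues: "card (unit_residues N) = totient N"
proof -
  have "unit_residues N = totatives N" by (auto simp: unit_residues_def totatives_def)
  then show ?thesis by (simp add: totient_def)
qed

lemma unit_residues_proportion_le_1: "1 / real (totient N) * real (card {a \<in> unit_residues N. Q a}) \<le> 1"
proof -
  have "card {a \<in> unit_residues N. Q a} \<le> totient N"
    using card_mono[OF finite_unit_residues, of "{a \<in> unit_residues N. Q a}" N] by (auto simp: card_unit_residues)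
  then show ?thesis by (auto simp: divide_le_eq_1)
qed

theorem theorem2:
  fixes C :: real
  assumes "0 < C"
  shows "\<exists>K::real. \<forall>N::nat. \<forall>t::real. 3 \<le> N \<longrightarrow> 0 < t \<longrightarrow> t \<le> ln (real N) powr C \<longrightarrow>
    1 / real (totient N)
      * real (card {a \<in> unit_residues N.
                 real (max_partial_quotient (real a / real N)) \<ge> t * ln (real N)})
    \<le> 12 / (pi\<^sup>2 * t) + K * (ln (ln (real N)) ^ 3 / (t * ln (real N)))"
proof -
  obtain c where c: "0 \<le> c" "\<And>n. 1 \<le> n \<Longrightarrow> totient_square_sum n \<le> 6 / pi ^ 2 * ln (real n) + c"
    using totient_square_sum_asymp_le by blast
  \<comment> \<open>In terms of \<open>l = ln (ln N)\<close> the last condition compares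
    \<open>exp (15 * l ^ 2)\<close> with \<open>80 * l * exp (l + 12 * l ^ 2 + 1)\<close>.\<close>
  have "eventually (\<lambda>N::nat. 5 \<le> ln (ln (real N)) \<and> 32000 * ln (ln (real N)) ^ 3 \<le> ln (real N)
      \<and> 80 * ln (ln (real N)) * ln (real N) * exp (12 * ln (ln (real N)) ^ 2 + 1) \<le> exp (15 * ln (ln (real N)) ^ 2)) at_top"
    by (intro eventually_conj) real_asymp+
  then obtain M :: nat where M: "\<And>N. M \<le> N \<Longrightarrow> 5 \<le> ln (ln (real N))"
      "\<And>N. M \<le> N \<Longrightarrow> 32000 * ln (ln (real N)) ^ 3 \<le> ln (real N)"
      "\<And>N. M \<le> N \<Longrightarrow> 80 * ln (ln (real N)) * ln (real N) * exp (12 * ln (ln (real N)) ^ 2 + 1) \<le> exp (15 * ln (ln (real N)) ^ 2)"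
    unfolding eventually_sequentially by blast
  define L0 l0 where "L0 = ln (real M)" and "l0 = ln (ln (3 :: real))"
  have ln3: "1 < ln (3 :: real)"
  proof -
    have "ln (exp 1) < ln (3 :: real)" using e_less_272 by (subst ln_less_cancel_iff) auto
    then show ?thesis by simp
  qed
  have l0: "0 < l0" using ln3 by (simp add: l0_def)
  \<comment> \<open>The second entry makes the error term at least 1 for every \<open>N\<close>
    below \<open>M\<close>: there \<open>t * L\<close> is at most \<open>L0 powr C * L0\<close> by
    the upper bound on \<open>t\<close>, and \<open>l\<close> is at least the positive number
    \<open>l0\<close>. This is how \<open>K\<close> comes to depend on \<open>C\<close>.\<close>
  define K where "K = max (16 * c + 16000) (L0 powr C * L0 / l0 ^ 3)"
  have K0: "0 \<le> K" using c(1) by (simp add: K_def le_max_iff_disj)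
  show ?thesis
  proof (intro exI[of _ K] allI impI)
    fix N :: nat and t :: real
    assume N: "3 \<le> N" and t0: "0 < t" and t: "t \<le> ln (real N) powr C"
    define L l where "L = ln (real N)" and "l = ln (ln (real N))"
    define A where "A = 1 / real (totient N)
      * real (card {a \<in> unit_residues N. t * L \<le> real (max_partial_quotient (real a / real N))})"
    have A1: "A \<le> 1" unfolding A_def by (rule unit_residues_proportion_le_1)
    have "ln 3 \<le> L" unfolding L_def using N by (intro ln_mono) auto
    then have L: "1 < L" and l: "l0 \<le> l"
      using ln3 by (auto simp: l_def l0_def L_def intro!: ln_mono)
    define R where "R = l ^ 3 / (t * L)"
    have R0: "0 \<le> R" using l l0 t0 L by (simp add: R_def)
    have "A \<le> 12 / (pi ^ 2 * t) + K * R"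
    proof (cases "t < 1")
      case True
      \<comment> \<open>For \<open>t < 1\<close> the main term alone exceeds the trivial bound 1,
        because \<open>pi ^ 2\<close> is below 12.\<close>
      have "pi ^ 2 * t \<le> 12 * 1"
      proof (rule mult_mono)
        have "pi ^ 2 \<le> (3.2) ^ 2" using pi_less_4 by (intro power_mono) (use pi_approx in auto)
        then show "pi ^ 2 \<le> 12" by (simp add: power2_eq_square)
      qed (use True t0 in auto)
      then have "1 \<le> 12 / (pi ^ 2 * t)" using t0 by simp
      moreover have "0 \<le> K * R" using K0 R0 by simp
      ultimately show ?thesis using A1 by linarith
    next
      case False
      show ?thesis
      proof (cases "M \<le> N")
        case True
        have "A \<le> 12 / (pi ^ 2 * t) + (16 * c + 16000) * R"
          unfolding A_def R_def l_def L_def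
          by (rule large_quotient_proportion_le[OF M[OF True] _ c]) (use False in auto)
        also have "(16 * c + 16000) * R \<le> K * R"
          using R0 by (intro mult_right_mono) (auto simp: K_def)
        finally show ?thesis by simp
      next
        case NM: False
        have LL: "L \<le> L0" unfolding L_def L0_def using N NM by (intro ln_mono) auto
        have "t * L \<le> L0 powr C * L0"
        proof (rule mult_mono)
          have "t \<le> L powr C" using t by (simp add: L_def)
          also have "\<dots> \<le> L0 powr C" using LL L assms by (intro powr_mono2) auto
          finally show "t \<le> L0 powr C" .
        qed (use LL L in auto)
        then have "1 \<le> L0 powr C * L0 / (t * L)" using t0 L by simp
        also have "\<dots> = L0 powr C * L0 / l0 ^ 3 * (l0 ^ 3 / (t * L))" using l0 by simp
        also have "\<dots> \<le> K * R"
          unfolding R_def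
        proof (intro mult_mono divide_right_mono power_mono)
          show "L0 powr C * L0 / l0 ^ 3 \<le> K" by (simp add: K_def)
        qed (use l l0 t0 L K0 in auto)
        finally have "1 \<le> K * R" .
        moreover have "0 \<le> 12 / (pi ^ 2 * t)" using t0 by simp
        ultimately show ?thesis using A1 by linarith
      qed
    qed
    then show "1 / real (totient N)
      * real (card {a \<in> unit_residues N.
                 real (max_partial_quotient (real a / real N)) \<ge> t * ln (real N)})
    \<le> 12 / (pi\<^sup>2 * t) + K * (ln (ln (real N)) ^ 3 / (t * ln (real N)))"
      by (simp add: A_def R_def L_def l_def)
  qed
qed

end
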